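(* Let $n\ge1$ and $\delta=(n,n-1,\ldots,1)$. Then $$2^{n^2}=\sum_{ST\in\mathcal{ST}^{\delta}(n,\overline n)}2^{\mathrm{str}(ST)-n}=\sum_{UA\in\mathcal{UA}^{\delta}(2n)}2^{\mathrm{neg}(UA)}=\sum_{CM\in\mathcal{CM}^{\delta}(2n)}2^{\mathrm{ns}(CM)}.$$
   Context: Let $[n,\overline n]=\{1,\ldots,n\}\cup\{\overline1,\ldots,\overline n\}$ be ordered by $\overline1<1<\overline2<2<\cdots<\overline n<n$. Matrix rows are numbered from the top, columns from the left. Shifted tableaux: $SF^\delta=\{(i,j):1\le i\le j\le n\}$. $\mathcal{ST}^\delta(n,\overline n)$ is the set of fillings $ST=(\eta_{ij})_{(i,j)\in SF^\delta}$ with $\eta_{ij}\in[n,\overline n]$, $\eta_{ii}\in\{i,\overline i\}$, $\eta_{ij}\le\eta_{i,j+1}$, $\eta_{ij}\le\eta_{i+1,j}$, $\eta_{ij}<\eta_{i+1,j+1}$ whenever the boxes lie in $SF^\delta$. $\mathrm{str}(ST)$ is the sum over all $c\in[n,\overline n]$ of the number of connected components of the set of boxes of $ST$ with entry $c$ (boxes being adjacent when they share an edge). U-turn matrices: $\mathcal{UA}^\delta(2n)$ is the set of $2n\times n$ matrices $UA=(a_{iq})$ with: $a_{iq}\in\{-1,0,1\}$; $\sum_{q=p}^n a_{iq}\in\{0,1\}$ for $1\le i\le 2n$, $1\le p\le n$; $\sum_{i=j}^{2n}a_{iq}\in\{0,1\}$ for $1\le j\le 2n$, $1\le q\le n$;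 $\sum_{q=1}^n(a_{2i-1,q}+a_{2i,q})=1$ for $1\le i\le n$; and $\sum_{i=1}^{2n}a_{iq}=1$ for $1\le q\le n$. $\mathrm{neg}(UA)$ is the number of entries $-1$. Square ice configuration matrices: consider the $2n\times n$ grid of internal vertices, each with four edges (up, down, left, right), shared with the neighbouring vertex or, at the border, a boundary edge. Orient all edges so that each internal vertex has exactly two incoming and two outgoing edges, and: every right boundary edge is incoming (points into the grid); every bottom and every top boundary edge is outgoing; for each $1\le i\le n$, exactly one of the left boundary edges of rows $2i-1$ and $2i$ is incoming and the other outgoing. To each such orientation associate the $2n\times n$ matrix $CM$ whose element at each vertex is: WE if the incoming edges are the left and right ones; NS if the incoming edges are the upper and lower ones; otherwise NE, SW, NW or SE according as the two outgoing edges are up and right, down and left, up and left, or down and right. $\mathcal{CM}^\delta(2n)$ is the set of all such $CM$, and $\mathrm{ns}(CM)$ is the number of elements NS. *)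

theory Defs
  imports Jordan_Normal_Form.Matrix "HOL-Library.FuncSet" Complex_Main
begin

datatype letter = Barred nat | Unbarred nat

primrec letter_rank :: "letter \<Rightarrow> nat" where
  "letter_rank (Barred k) = 2 * k"
| "letter_rank (Unbarred k) = 2 * k + 1"

lemma letter_rank_inject: "letter_rank x = letter_rank y \<longleftrightarrow> x = y"
  by (cases x; cases y; simp) presburger+

text \<open>The order \<open>Barred 1 < Unbarred 1 < Barred 2 < Unbarred 2 < \<dots>\<close>.\<close>

instantiation letter :: linorder
begin

definition less_eq_letter :: "letter \<Rightarrow> letter \<Rightarrow> bool" where
  "x \<le> y \<longleftrightarrow> letter_rank x \<le> letter_rank y"

definition less_letter :: "letter \<Rightarrow> letter \<Rightarrow> bool" where
  "x < y \<longleftrightarrow> letter_rank x < letter_rank y"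

instance
  by standard (auto simp: less_eq_letter_def less_letter_def letter_rank_inject)

end

definition letters :: "nat \<Rightarrow> letter set" where
  "letters n = Unbarred ` {1..n} \<union> Barred ` {1..n}"

definition shifted_shape :: "nat \<Rightarrow> (nat \<times> nat) set" where
  "shifted_shape n = {(i, j). 1 \<le> i \<and> i \<le> j \<and> j \<le> n}"

definition shifted_tableaux :: "nat \<Rightarrow> (nat \<times> nat \<Rightarrow> letter) set" where
  "shifted_tableaux n = {T \<in> shifted_shape n \<rightarrow>\<^sub>E letters n.
     (\<forall>i \<in> {1..n}. T (i, i) \<in> {Unbarred i, Barred i}) \<and>
     (\<forall>(i, j) \<in> shifted_shape n. (i, j + 1) \<in> shifted_shape n \<longrightarrow> T (i, j) \<le> T (i, j + 1)) \<and>
     (\<forall>(i, j) \<in> shifted_shape n. (i + 1, j) \<in> shifted_shape n \<longrightarrow> T (i, j) \<le> T (i + 1, j)) \<and>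
     (\<forall>(i, j) \<in> shifted_shape n. (i + 1, j + 1) \<in> shifted_shape n \<longrightarrow> T (i, j) < T (i + 1, j + 1))}"

definition box_adjacent :: "nat \<times> nat \<Rightarrow> nat \<times> nat \<Rightarrow> bool" where
  "box_adjacent b b' \<longleftrightarrow>
     fst b = fst b' \<and> (snd b' = snd b + 1 \<or> snd b = snd b' + 1) \<or>
     snd b = snd b' \<and> (fst b' = fst b + 1 \<or> fst b = fst b' + 1)"

definition box_components :: "(nat \<times> nat) set \<Rightarrow> (nat \<times> nat) set set" where
  "box_components B = B // {(b, b'). b \<in> B \<and> b' \<in> B \<and> box_adjacent b b'}\<^sup>*"

definition str :: "nat \<Rightarrow> (nat \<times> nat \<Rightarrow> letter) \<Rightarrow> nat" where
  "str n T = (\<Sum>c \<in> letters n. card (box_components {b \<in> shifted_shape n. T b = c}))"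

text \<open>Matrix rows and columns are indexed from 0, so the rows \<open>2i - 1\<close> and
  \<open>2i\<close> paired by the U-turns become \<open>2 * i\<close> and \<open>2 * i + 1\<close> with \<open>i < n\<close>.\<close>

definition uturn_matrices :: "nat \<Rightarrow> int mat set" where
  "uturn_matrices n = {A \<in> carrier_mat (2 * n) n.
     (\<forall>i < 2 * n. \<forall>q < n. A $$ (i, q) \<in> {-1, 0, 1}) \<and>
     (\<forall>i < 2 * n. \<forall>p < n. (\<Sum>q = p..<n. A $$ (i, q)) \<in> {0, 1}) \<and>
     (\<forall>j < 2 * n. \<forall>q < n. (\<Sum>i = j..<2 * n. A $$ (i, q)) \<in> {0, 1}) \<and>
     (\<forall>i < n. (\<Sum>q < n. A $$ (2 * i, q) + A $$ (2 * i + 1, q)) = 1) \<and>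
     (\<forall>q < n. (\<Sum>i < 2 * n. A $$ (i, q)) = 1)}"

definition neg :: "int mat \<Rightarrow> nat" where
  "neg A = card {(i, q). i < dim_row A \<and> q < dim_col A \<and> A $$ (i, q) = -1}"

text \<open>The vertices are \<open>(i, j)\<close> with \<open>i < 2 * n\<close> and \<open>j < n\<close>. An orientation is given
  by functions \<open>h\<close> and \<open>v\<close>: \<open>h i j\<close> is the direction of the horizontal edge of row \<open>i\<close> immediately
  left of vertex \<open>(i, j)\<close>, so that \<open>h i 0\<close> and \<open>h i n\<close> are the boundary edges of the row;
  \<open>v i j\<close> is the direction of the vertical edge of column \<open>j\<close> immediately above vertex \<open>(i, j)\<close>,
  so that \<open>v 0 j\<close> and \<open>v (2 * n) j\<close> are the boundary edges of the column.\<close>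

datatype hdir = Leftward | Rightward
datatype vdir = Upward | Downward

datatype side = LeftSide | RightSide | UpSide | DownSide

definition incoming :: "(nat \<Rightarrow> nat \<Rightarrow> hdir) \<Rightarrow> (nat \<Rightarrow> nat \<Rightarrow> vdir) \<Rightarrow> nat \<Rightarrow> nat \<Rightarrow> side set" where
  "incoming h v i j = {s. case s of
      LeftSide \<Rightarrow> h i j = Rightward
    | RightSide \<Rightarrow> h i (j + 1) = Leftward
    | UpSide \<Rightarrow> v i j = Downward
    | DownSide \<Rightarrow> v (i + 1) j = Upward}"

definition outgoing :: "(nat \<Rightarrow> nat \<Rightarrow> hdir) \<Rightarrow> (nat \<Rightarrow> nat \<Rightarrow> vdir) \<Rightarrow> nat \<Rightarrow> nat \<Rightarrow> side set" where
  "outgoing h v i j = - incoming h v i j"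

definition square_ice :: "nat \<Rightarrow> (nat \<Rightarrow> nat \<Rightarrow> hdir) \<Rightarrow> (nat \<Rightarrow> nat \<Rightarrow> vdir) \<Rightarrow> bool" where
  "square_ice n h v \<longleftrightarrow>
     (\<forall>i < 2 * n. \<forall>j < n. card (incoming h v i j) = 2 \<and> card (outgoing h v i j) = 2) \<and>
     (\<forall>i < 2 * n. h i n = Leftward) \<and>
     (\<forall>j < n. v (2 * n) j = Downward) \<and>
     (\<forall>j < n. v 0 j = Upward) \<and>
     (\<forall>i < n. (h (2 * i) 0 = Rightward \<and> h (2 * i + 1) 0 = Leftward) \<or>
              (h (2 * i) 0 = Leftward \<and> h (2 * i + 1) 0 = Rightward))"

datatype compass = WE | NS | NE | SW | NW | SE

definition vertex_compass ::
  "(nat \<Rightarrow> nat \<Rightarrow> hdir) \<Rightarrow> (nat \<Rightarrow> nat \<Rightarrow> vdir) \<Rightarrow> nat \<Rightarrow> nat \<Rightarrow> compass" where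
  "vertex_compass h v i j =
    (if incoming h v i j = {LeftSide, RightSide} then WE
     else if incoming h v i j = {UpSide, DownSide} then NS
     else if outgoing h v i j = {UpSide, RightSide} then NE
     else if outgoing h v i j = {DownSide, LeftSide} then SW
     else if outgoing h v i j = {UpSide, LeftSide} then NW
     else SE)"

definition compass_matrices :: "nat \<Rightarrow> compass mat set" where
  "compass_matrices n =
     {mat (2 * n) n (\<lambda>(i, j). vertex_compass h v i j) | h v. square_ice n h v}"

definition ns :: "compass mat \<Rightarrow> nat" where
  "ns C = card {(i, j). i < dim_row C \<and> j < dim_col C \<and> C $$ (i, j) = NS}"

end

theory Submission
  imports Defs Jordan_Normal_Form.Determinant
begin

text \<open>
  Reading a shifted tableau along its diagonals gives a triangle of strictly increasing rows
  of lengths \<open>n, n - 1, \<dots>, 1\<close> in which consecutive rows interlace, and whose longest row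
  takes one letter from each pair \<open>Barred i, Unbarred i\<close>. The same triangles arise from U-turn
  matrices, the row of length \<open>m\<close> listing the matrix rows whose last \<open>m\<close> entries sum to 1. Both
  \<open>neg\<close> and \<open>str - n\<close> then count the entries of a row that are missing from the next longer row.
  An ice configuration is the array of right and lower partial sums of a U-turn matrix.

  Given a row \<open>d\<close> of length \<open>m + 1\<close>, summing a function over the entry between \<open>d i\<close> and
  \<open>d (i + 1)\<close>, with weight 2 inside the interval and 1 at its ends, is the trapezoidal rule, which
  telescopes on binomial coefficients. Hence, by multilinearity of the determinant and induction
  on \<open>m\<close>, the weighted number of triangles with longest row \<open>d\<close> is
  \<open>2 ^ (n (n - 1) / 2) det (d i choose j)\<close>; sequences that are not strictly increasing contribute a
  determinant with two equal rows. Summing over \<open>d i \<in> {2 i, 2 i + 1}\<close> leaves a single determinant,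
  which factors into triangular matrices.
\<close>

section \<open>Binomial determinants\<close>

lemma det_mat_lower_triangular:
  fixes f :: "nat \<Rightarrow> nat \<Rightarrow> 'a :: comm_ring_1"
  assumes "\<And>i j. i < j \<Longrightarrow> j < n \<Longrightarrow> f i j = 0"
  shows "det (mat n n (\<lambda>(i, j). f i j)) = (\<Prod>i<n. f i i)"
  by (subst det_lower_triangular[where n = n])
    (use assms in \<open>auto simp: prod_list_diag_prod lessThan_atLeast0\<close>)

lemma det_mat_upper_triangular:
  fixes f :: "nat \<Rightarrow> nat \<Rightarrow> 'a :: comm_ring_1"
  assumes "\<And>i j. j < i \<Longrightarrow> i < n \<Longrightarrow> f i j = 0"
  shows "det (mat n n (\<lambda>(i, j). f i j)) = (\<Prod>i<n. f i i)"
  by (subst det_upper_triangular[where n = n])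
    (use assms in \<open>auto simp: prod_list_diag_prod lessThan_atLeast0\<close>)

lemma det_mat_mult:
  fixes f g :: "nat \<Rightarrow> nat \<Rightarrow> 'a :: comm_ring_1"
  shows "det (mat n n (\<lambda>(i, j). \<Sum>k<n. f i k * g k j))
    = det (mat n n (\<lambda>(i, j). f i j)) * det (mat n n (\<lambda>(i, j). g i j))"
proof -
  have "mat n n (\<lambda>(i, j). \<Sum>k<n. f i k * g k j)
      = mat n n (\<lambda>(i, j). f i j) * mat n n (\<lambda>(i, j). g i j)"
    by (rule eq_matI) (auto simp: scalar_prod_def lessThan_atLeast0)
  then show ?thesis
    by (simp add: det_mult[where n = n])
qed

text \<open>Multilinearity of the determinant in its rows. In the Leibniz formula the sum over all
  choice functions can be carried out for each permutation separately, where it turns a sum of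
  products into a product of sums.\<close>

lemma sum_PiE_det:
  fixes f :: "'b \<Rightarrow> nat \<Rightarrow> 'a :: comm_ring_1"
  assumes "\<And>i. i < n \<Longrightarrow> finite (B i)"
  shows "(\<Sum>e \<in> PiE {..<n} B. (\<Prod>i<n. w i (e i)) * det (mat n n (\<lambda>(i, j). f (e i) j)))
    = det (mat n n (\<lambda>(i, j). \<Sum>x \<in> B i. w i x * f x j))"
proof -
  let ?P = "{p. p permutes {0..<n}}"
  have "(\<Sum>e \<in> PiE {..<n} B. (\<Prod>i<n. w i (e i)) * det (mat n n (\<lambda>(i, j). f (e i) j)))
      = (\<Sum>e \<in> PiE {..<n} B. \<Sum>p \<in> ?P. signof p * (\<Prod>i<n. w i (e i) * f (e i) (p i)))"
    by (intro sum.cong refl, subst det_def'[where n = n])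
      (auto simp: sum_distrib_left prod.distrib lessThan_atLeast0 mult_ac intro!: sum.cong prod.cong)
  also have "\<dots> = (\<Sum>p \<in> ?P. signof p * (\<Sum>e \<in> PiE {..<n} B. \<Prod>i<n. w i (e i) * f (e i) (p i)))"
    by (subst sum.swap) (simp add: sum_distrib_left)
  also have "\<dots> = (\<Sum>p \<in> ?P. signof p * (\<Prod>i<n. \<Sum>x \<in> B i. w i x * f x (p i)))"
    by (subst prod_sum_PiE) (use assms in auto)
  also have "\<dots> = det (mat n n (\<lambda>(i, j). \<Sum>x \<in> B i. w i x * f x j))"
    by (subst det_def'[where n = n])
      (auto simp: lessThan_atLeast0 intro!: sum.cong prod.cong)
  finally show ?thesis .
qed

definition binomial_det :: "nat \<Rightarrow> (nat \<Rightarrow> nat) \<Rightarrow> int" where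
  "binomial_det n d = det (mat n n (\<lambda>(i, j). int (d i choose j)))"

lemma binomial_det_eq_0:
  assumes "i < k" "k < n" "d i = d k"
  shows "binomial_det n d = 0"
  unfolding binomial_det_def
  by (rule det_identical_rows[where i = i and j = k]) (use assms in auto)

section \<open>The trapezoidal rule on binomial coefficients\<close>

definition trapezoid_weight :: "nat \<Rightarrow> nat \<Rightarrow> nat \<Rightarrow> int" where
  "trapezoid_weight a b x = (if x = a \<or> x = b then 1 else 2)"

text \<open>An interior point is an end of two of the unit steps from \<open>a\<close> to
  \<open>b\<close>, each of the points \<open>a\<close> and \<open>b\<close> of only one. Strictness
  of \<open>a < b\<close> matters: for \<open>a = b\<close> the left side is \<open>f a\<close>
  while the right side is empty.\<close>

lemma sum_trapezoid_weight:
  assumes "a < b"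
  shows "(\<Sum>x=a..b. trapezoid_weight a b x * f x) = (\<Sum>x=a..<b. f x + f (Suc x))"
proof -
  obtain c where "b = Suc (a + c)"
    using assms less_imp_Suc_add by blast
  moreover have "(\<Sum>x=a..Suc (a + c). trapezoid_weight a (Suc (a + c)) x * f x)
      = (\<Sum>x=a..<Suc (a + c). f x + f (Suc x))"
  proof (induction c)
    case 0
    then show ?case by (simp add: trapezoid_weight_def)
  next
    case (Suc c)
    define b where "b = Suc (a + c)"
    have ab: "a < b" by (simp add: b_def)
    have "(\<Sum>x=a..Suc b. trapezoid_weight a (Suc b) x * f x)
        = (\<Sum>x=a..<b. trapezoid_weight a (Suc b) x * f x) + 2 * f b + f (Suc b)"
      using ab by (simp add: trapezoid_weight_def flip: atLeastLessThanSuc_atLeastAtMost)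
    also have "(\<Sum>x=a..<b. trapezoid_weight a (Suc b) x * f x)
        = (\<Sum>x=a..<b. trapezoid_weight a b x * f x)"
      by (rule sum.cong) (auto simp: trapezoid_weight_def)
    also have "\<dots> = (\<Sum>x=a..b. trapezoid_weight a b x * f x) - f b"
      using ab by (simp add: trapezoid_weight_def flip: atLeastLessThanSuc_atLeastAtMost)
    finally show ?case
      using Suc ab by (simp add: b_def)
  qed
  ultimately show ?thesis by simp
qed

text \<open>An antidifference of \<open>(x choose j) + (Suc x choose j)\<close>, which Pascal's rule
  rewrites as \<open>2 * (x choose j)\<close> plus, for positive \<open>j\<close>,
  \<open>x choose (j - 1)\<close>.\<close>

definition trapezoid_antidiff :: "nat \<Rightarrow> nat \<Rightarrow> int" where
  "trapezoid_antidiff j x = int (x choose j) + 2 * int (x choose Suc j)"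

lemma sum_trapezoid_choose:
  assumes "a < b"
  shows "(\<Sum>x=a..b. trapezoid_weight a b x * int (x choose j))
    = trapezoid_antidiff j b - trapezoid_antidiff j a"
proof -
  have "int (x choose j) + int (Suc x choose j) = trapezoid_antidiff j (Suc x) - trapezoid_antidiff j x" for x
    by (cases j) (auto simp: trapezoid_antidiff_def)
  then show ?thesis
    using assms by (simp add: sum_trapezoid_weight sum_Suc_diff')
qed

text \<open>Border the matrix to size \<open>Suc n\<close>, with \<open>1, 0, ..., 0\<close> as new
  first column. Partial sums of the rows then undo the differences and leave the values
  \<open>g (d i) j\<close>. These form the binomial matrix times a bidiagonal matrix of determinant
  \<open>2 ^ n\<close>.\<close>

lemma det_antidiff_differences:
  "det (mat n n (\<lambda>(i, j). trapezoid_antidiff j (d (Suc i)) - trapezoid_antidiff j (d i)))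
    = 2 ^ n * binomial_det (Suc n) d"
proof -
  define M where "M = mat n n (\<lambda>(i, j). trapezoid_antidiff j (d (Suc i)) - trapezoid_antidiff j (d i))"
  \<comment> \<open>Column 0 is constantly 1, so its row differences vanish below the top entry;
    column \<open>Suc j\<close> holds the antidifference of index \<open>j\<close>.\<close>
  define g where "g x j = (case j of 0 \<Rightarrow> 1 | Suc j' \<Rightarrow> trapezoid_antidiff j' x)" for x j :: nat
  define N where "N i j = (case i of 0 \<Rightarrow> g (d 0) j | Suc i' \<Rightarrow> g (d i) j - g (d i') j)" for i j
  define L where "L i k = (if k \<le> i then 1 else 0 :: int)" for i k :: nat
  \<comment> \<open>Column \<open>Suc m\<close> of \<open>g\<close> is column \<open>m\<close> of
    the binomial matrix plus twice its column \<open>Suc m\<close>.\<close>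
  define U where "U k j = (if k = j then (if j = 0 then 1 else 2)
    else if Suc k = j then 1 else 0 :: int)" for k j :: nat
  have LN: "(\<Sum>k<Suc n. L i k * N k j) = g (d i) j" if "i < Suc n" for i j
  proof -
    have "(\<Sum>k<Suc n. L i k * N k j) = (\<Sum>k\<le>i. N k j)"
      using that by (intro sum.mono_neutral_cong_right) (auto simp: L_def)
    also have "\<dots> = g (d i) j"
      by (induction i) (simp_all add: N_def)
    finally show ?thesis .
  qed
  have CU: "(\<Sum>k<Suc n. int (d i choose k) * U k j) = g (d i) j" if "j < Suc n" for i j
  proof (cases j)
    case 0
    have "(\<Sum>k<Suc n. int (d i choose k) * U k j) = (\<Sum>k\<in>{0}. int (d i choose k) * U k j)"
      by (rule sum.mono_neutral_right) (auto simp: U_def 0)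
    then show ?thesis by (simp add: g_def 0 U_def)
  next
    case (Suc m)
    have "(\<Sum>k<Suc n. int (d i choose k) * U k j) = (\<Sum>k\<in>{m, Suc m}. int (d i choose k) * U k j)"
      by (rule sum.mono_neutral_right) (use that in \<open>auto simp: U_def Suc\<close>)
    then show ?thesis by (simp add: g_def Suc U_def trapezoid_antidiff_def)
  qed
  have "det (mat (Suc n) (Suc n) (\<lambda>(i, j). N i j))
      = det (mat (Suc n) (Suc n) (\<lambda>(i, j). L i j)) * det (mat (Suc n) (Suc n) (\<lambda>(i, j). N i j))"
    by (subst det_mat_lower_triangular) (auto simp: L_def)
  also have "\<dots> = det (mat (Suc n) (Suc n) (\<lambda>(i, j). g (d i) j))"
    unfolding det_mat_mult[symmetric] by (intro arg_cong[where f = det] cong_mat)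
      (auto simp del: sum.lessThan_Suc simp: LN)
  also have "\<dots> = binomial_det (Suc n) d * det (mat (Suc n) (Suc n) (\<lambda>(i, j). U i j))"
    unfolding binomial_det_def det_mat_mult[symmetric] by (intro arg_cong[where f = det] cong_mat)
      (auto simp del: sum.lessThan_Suc simp: CU)
  also have "det (mat (Suc n) (Suc n) (\<lambda>(i, j). U i j)) = (\<Prod>i<Suc n. if i = 0 then 1 else 2)"
    by (subst det_mat_upper_triangular) (auto simp: U_def intro!: prod.cong)
  also have "\<dots> = 2 ^ n"
    by (subst prod.lessThan_Suc_shift) simp
  finally have *: "det (mat (Suc n) (Suc n) (\<lambda>(i, j). N i j)) = 2 ^ n * binomial_det (Suc n) d"
    by simp
  let ?N = "mat (Suc n) (Suc n) (\<lambda>(i, j). N i j)"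
  \<comment> \<open>Laplace expansion along column 0 removes the border again.\<close>
  have "det ?N = (\<Sum>i<Suc n. ?N $$ (i, 0) * cofactor ?N i 0)"
    by (rule laplace_expansion_column) auto
  also have "\<dots> = (\<Sum>i\<in>{0}. ?N $$ (i, 0) * cofactor ?N i 0)"
    by (rule sum.mono_neutral_right) (auto simp: N_def g_def split: nat.splits)
  also have "\<dots> = cofactor ?N 0 0"
    by (simp add: N_def g_def)
  also have "\<dots> = det (mat_delete ?N 0 0)"
    by (simp add: cofactor_def)
  also have "mat_delete ?N 0 0 = M"
    by (rule eq_matI) (auto simp: mat_delete_def M_def N_def g_def)
  finally show ?thesis
    using * by (simp add: M_def)
qed

text \<open>The entry is the coefficient of t^j in (1 + t)^(2i) (2 + t). Expanding (1 + t)^2 = 1 + t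
  (2 + t) by the binomial theorem factors the matrix into the unitriangular matrix
  \<open>i choose k\<close> and the coefficients of t^k (2 + t)^(k+1), which form an upper
  triangular matrix with diagonal entries \<open>2 ^ Suc k\<close>.\<close>

lemma det_choose_double:
  "det (mat n n (\<lambda>(i, j). int ((2 * i) choose j) + int (Suc (2 * i) choose j))) = (\<Prod>k<n. 2 ^ Suc k)"
proof -
  define U where "U k j = coeff ([:0, 2, 1:] ^ k * [:2, 1:] :: int poly) j" for k j
  have U: "U k j = (if j < k then 0 else coeff ([:2, 1:] ^ Suc k) (j - k))" for k j
  proof -
    have "[:0, 2, 1:] = (monom 1 1 * [:2, 1:] :: int poly)"
      by (simp add: monom_altdef)
    then have "[:0, 2, 1:] ^ k * [:2, 1:] = (monom 1 k * [:2, 1:] ^ Suc k :: int poly)"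
      by (simp only: power_mult_distrib monom_power power_one power_Suc mult_ac mult_1 mult_1_right)
    then show ?thesis
      unfolding U_def by (simp add: coeff_monom_mult)
  qed
  have choose: "coeff ([:1, 1:] ^ m :: int poly) j = int (m choose j)" for m j
  proof (cases "j \<le> m")
    case False
    have "degree ([:1, 1:] ^ m :: int poly) = m"
      by (simp add: degree_power_eq)
    with False show ?thesis
      by (simp add: coeff_eq_0)
  qed (simp add: coeff_linear_poly_power)
  have "int ((2 * i) choose j) + int (Suc (2 * i) choose j) = (\<Sum>k<n. int (i choose k) * U k j)"
    if "i < n" for i j
  proof -
    have "int ((2 * i) choose j) + int (Suc (2 * i) choose j) =
        coeff ([:1, 1:] ^ (2 * i) + [:1, 1:] ^ Suc (2 * i)) j"
      by (simp only: choose coeff_add)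
    also have "[:1, 1:] ^ (2 * i) + [:1, 1:] ^ Suc (2 * i) = ([:1, 1:] ^ 2) ^ i * ([:2, 1:] :: int poly)"
    proof -
      have "[:1, 1:] ^ (2 * i) + [:1, 1:] ^ Suc (2 * i) = [:1, 1:] ^ (2 * i) * (1 + [:1, 1:] :: int poly)"
        by (simp only: power_Suc ring_distribs mult_1_right mult_ac)
      also have "1 + [:1, 1:] = ([:2, 1:] :: int poly)"
        by (simp add: one_pCons)
      finally show ?thesis by (simp only: power_mult)
    qed
    also have "[:1, 1:] ^ 2 = ([:0, 2, 1:] + 1 :: int poly)"
      by (simp add: power2_eq_square one_pCons)
    also have "([:0, 2, 1:] + 1) ^ i = (\<Sum>k\<le>i. of_nat (i choose k) * [:0, 2, 1:] ^ k :: int poly)"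
      by (subst binomial_ring) simp
    also have "coeff (\<dots> * [:2, 1:]) j = (\<Sum>k\<le>i. int (i choose k) * U k j)"
      by (simp add: sum_distrib_right coeff_sum U_def of_nat_poly mult.assoc del: mult_pCons_right)
    also have "\<dots> = (\<Sum>k<n. int (i choose k) * U k j)"
      using that by (intro sum.mono_neutral_left) auto
    finally show ?thesis .
  qed
  then have "det (mat n n (\<lambda>(i, j). int ((2 * i) choose j) + int (Suc (2 * i) choose j)))
      = det (mat n n (\<lambda>(i, j). \<Sum>k<n. int (i choose k) * U k j))"
    by (intro arg_cong[where f = det] cong_mat) (auto simp del: binomial_Suc_Suc)
  also have "\<dots> = det (mat n n (\<lambda>(i, j). int (i choose j))) * det (mat n n (\<lambda>(i, j). U i j))"
    by (rule det_mat_mult)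
  also have "det (mat n n (\<lambda>(i, j). int (i choose j))) = 1"
    by (subst det_mat_lower_triangular) auto
  also have "det (mat n n (\<lambda>(i, j). U i j)) = (\<Prod>k<n. 2 ^ Suc k)"
    by (subst det_mat_upper_triangular)
      (auto simp: U coeff_0_power simp del: power_Suc intro!: prod.cong)
  finally show ?thesis by simp
qed

section \<open>Weighted sums over interlacing triangles\<close>

definition increasing_rows :: "nat \<Rightarrow> nat \<Rightarrow> (nat \<Rightarrow> nat) set" where
  "increasing_rows N m = {e \<in> {..<m} \<rightarrow>\<^sub>E {..<N}. strict_mono_on {..<m} e}"

definition interlaced :: "nat \<Rightarrow> (nat \<Rightarrow> nat) \<Rightarrow> (nat \<Rightarrow> nat) \<Rightarrow> bool" where
  "interlaced m e d \<longleftrightarrow> (\<forall>i<m. d i \<le> e i \<and> e i \<le> d (Suc i))"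

text \<open>Rows are indexed by their length, so row 0 is the empty sequence and row
  \<open>n\<close> the longest. Both levels are extensional, so each triangle is a single
  function.\<close>

definition triangles :: "nat \<Rightarrow> nat \<Rightarrow> (nat \<Rightarrow> nat \<Rightarrow> nat) set" where
  "triangles N n = {E \<in> PiE {..n} (increasing_rows N). \<forall>m<n. interlaced m (E m) (E (Suc m))}"

definition departures :: "nat \<Rightarrow> (nat \<Rightarrow> nat \<Rightarrow> nat) \<Rightarrow> nat" where
  "departures n E = (\<Sum>m<n. card (E m ` {..<m} - E (Suc m) ` {..<Suc m}))"

lemma increasing_rowsD:
  assumes "e \<in> increasing_rows N m"
  shows "i < m \<Longrightarrow> e i < N" "i < j \<Longrightarrow> j < m \<Longrightarrow> e i < e j"
    "\<not> i < m \<Longrightarrow> e i = undefined" "inj_on e {..<m}"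
proof -
  have e: "e \<in> {..<m} \<rightarrow>\<^sub>E {..<N}" "strict_mono_on {..<m} e"
    using assms by (simp_all add: increasing_rows_def)
  show "i < m \<Longrightarrow> e i < N"
    using PiE_mem[OF e(1), of i] by simp
  show "i < j \<Longrightarrow> j < m \<Longrightarrow> e i < e j"
    using strict_mono_onD[OF e(2), of i j] by simp
  show "\<not> i < m \<Longrightarrow> e i = undefined"
    using PiE_arb[OF e(1), of i] by simp
  show "inj_on e {..<m}"
    by (rule strict_mono_on_imp_inj_on[OF e(2)])
qed

lemma increasing_rows_less_iff:
  assumes "e \<in> increasing_rows N m" "i < m" "j < m"
  shows "e i < e j \<longleftrightarrow> i < j"
  using increasing_rowsD(2)[OF assms(1), of i j] increasing_rowsD(2)[OF assms(1), of j i] assms(2, 3)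
  by (cases i j rule: linorder_cases) auto

lemma increasing_rowsI:
  assumes "e \<in> extensional {..<m}" "\<And>i. i < m \<Longrightarrow> e i < N" "\<And>i. Suc i < m \<Longrightarrow> e i < e (Suc i)"
  shows "e \<in> increasing_rows N m"
proof -
  have "e i < e j" if "i < j" "j < m" for i j
    using that
  proof (induction j)
    case (Suc j)
    with assms(3)[of j] show ?case by (cases "i = j") auto
  qed simp
  with assms show ?thesis
    by (simp add: increasing_rows_def PiE_iff strict_mono_on_def)
qed

lemma finite_increasing_rows: "finite (increasing_rows N m)"
  unfolding increasing_rows_def by (rule finite_subset[where B = "{..<m} \<rightarrow>\<^sub>E {..<N}"]) (auto intro: finite_PiE)

lemma finite_triangles: "finite (triangles N n)"
  unfolding triangles_def
  by (rule finite_subset[where B = "PiE {..n} (increasing_rows N)"]) (auto intro!: finite_PiE finite_increasing_rows)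

lemma trianglesD:
  assumes "E \<in> triangles N n"
  shows "m \<le> n \<Longrightarrow> E m \<in> increasing_rows N m"
    and "m < n \<Longrightarrow> i < m \<Longrightarrow> E (Suc m) i \<le> E m i"
    and "m < n \<Longrightarrow> i < m \<Longrightarrow> E m i \<le> E (Suc m) (Suc i)"
    and "E \<in> extensional {..n}"
  using assms by (auto simp: triangles_def PiE_iff interlaced_def)

lemma interlaced_increasing_rows_subset:
  "{e \<in> increasing_rows N n. interlaced n e d} \<subseteq> PiE {..<n} (\<lambda>i. {d i..d (Suc i)})"
  by (auto simp: increasing_rows_def interlaced_def PiE_def)

text \<open>By interlacing and strict monotonicity, the only entries of \<open>d\<close> that
  \<open>e i\<close> can equal are \<open>d i\<close> and \<open>d (Suc i)\<close>. The weight is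
  therefore 2 exactly at the entries of \<open>e\<close> missing from \<open>d\<close>.\<close>

lemma prod_trapezoid_weight:
  assumes "d \<in> increasing_rows N (Suc n)" "e \<in> increasing_rows N n" "interlaced n e d"
  shows "(\<Prod>i<n. trapezoid_weight (d i) (d (Suc i)) (e i)) = 2 ^ card (e ` {..<n} - d ` {..<Suc n})"
proof -
  have mem: "e i \<in> d ` {..<Suc n} \<longleftrightarrow> e i = d i \<or> e i = d (Suc i)" if i: "i < n" for i
  proof
    assume "e i \<in> d ` {..<Suc n}"
    then obtain k where k: "k < Suc n" "e i = d k" by auto
    have *: "d i \<le> d k" "d k \<le> d (Suc i)"
      using assms(3) i k by (auto simp: interlaced_def)
    have "i \<le> k" "k \<le> Suc i"
      using * increasing_rows_less_iff[OF assms(1)] i k(1) by (auto simp: not_less[symmetric])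
    then show "e i = d i \<or> e i = d (Suc i)"
      using k by (auto simp: le_Suc_eq)
  qed (use i in auto)
  have "(\<Prod>i<n. trapezoid_weight (d i) (d (Suc i)) (e i)) = (\<Prod>i<n. if e i \<in> d ` {..<Suc n} then 1 else 2)"
    by (rule prod.cong) (simp_all only: mem trapezoid_weight_def lessThan_iff)
  also have "\<dots> = 2 ^ card ({..<n} - {i. e i \<in> d ` {..<Suc n}})"
    by (subst prod.If_cases) (auto simp: Diff_eq)
  also have "card ({..<n} - {i. e i \<in> d ` {..<Suc n}}) = card (e ` ({..<n} - {i. e i \<in> d ` {..<Suc n}}))"
    by (rule card_image[symmetric]) (rule inj_on_subset[OF increasing_rowsD(4)[OF assms(2)]], auto)
  also have "e ` ({..<n} - {i. e i \<in> d ` {..<Suc n}}) = e ` {..<n} - d ` {..<Suc n}"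
    by auto
  finally show ?thesis .
qed

text \<open>Enlarging the sum to all choices of \<open>e i\<close> between \<open>d i\<close> and
  \<open>d (Suc i)\<close> makes the positions independent, so that multilinearity and the
  trapezoidal rule apply.\<close>

lemma sum_interlaced:
  assumes d: "d \<in> increasing_rows N (Suc n)"
  shows "(\<Sum>e | e \<in> increasing_rows N n \<and> interlaced n e d.
      2 ^ card (e ` {..<n} - d ` {..<Suc n}) * binomial_det n e) = 2 ^ n * binomial_det (Suc n) d"
proof -
  have lt: "d i < d (Suc i)" if "i < n" for i
    using increasing_rowsD(2)[OF d] that by auto
  define w where "w i = trapezoid_weight (d i) (d (Suc i))" for i
  let ?B = "\<lambda>i. {d i..d (Suc i)}"
  have "(\<Sum>e | e \<in> increasing_rows N n \<and> interlaced n e d.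
      2 ^ card (e ` {..<n} - d ` {..<Suc n}) * binomial_det n e)
    = (\<Sum>e | e \<in> increasing_rows N n \<and> interlaced n e d. (\<Prod>i<n. w i (e i)) * binomial_det n e)"
    by (rule sum.cong) (auto simp: w_def prod_trapezoid_weight[OF d])
  \<comment> \<open>The added choices are not strictly increasing and contribute 0.\<close>
  also have "\<dots> = (\<Sum>e \<in> PiE {..<n} ?B. (\<Prod>i<n. w i (e i)) * binomial_det n e)"
  proof (rule sum.mono_neutral_left)
    show "\<forall>e \<in> PiE {..<n} ?B - {e. e \<in> increasing_rows N n \<and> interlaced n e d}.
        (\<Prod>i<n. w i (e i)) * binomial_det n e = 0"
    proof
      fix e assume e: "e \<in> PiE {..<n} ?B - {e. e \<in> increasing_rows N n \<and> interlaced n e d}"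
      have bounds: "d i \<le> e i" "e i \<le> d (Suc i)" if "i < n" for i
        using e that by (auto simp: PiE_iff)
      have "\<exists>i. Suc i < n \<and> e (Suc i) \<le> e i"
      proof (rule ccontr)
        assume *: "\<not> ?thesis"
        have "e \<in> increasing_rows N n"
        proof (rule increasing_rowsI)
          show "e i < N" if "i < n" for i
            using bounds(2)[OF that] increasing_rowsD(1)[OF d, of "Suc i"] that by simp
        qed (use e * in \<open>auto simp: PiE_iff not_le\<close>)
        moreover have "interlaced n e d"
          using bounds by (auto simp: interlaced_def)
        ultimately show False
          using e by blast
      qed
      then obtain i where i: "Suc i < n" "e (Suc i) \<le> e i" by blast
      \<comment> \<open>Both entries are squeezed against a common bound:
        \<open>e i \<le> d (Suc i) \<le> e (Suc i)\<close>.\<close>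
      then have "e i = e (Suc i)"
        using bounds(2)[of i] bounds(1)[of "Suc i"] by auto
      then show "(\<Prod>i<n. w i (e i)) * binomial_det n e = 0"
        using i binomial_det_eq_0[of i "Suc i" n e] by simp
    qed
  qed (use interlaced_increasing_rows_subset[of N n d] in \<open>auto intro: finite_PiE\<close>)
  also have "\<dots> = det (mat n n (\<lambda>(i, j). \<Sum>x=d i..d (Suc i). w i x * int (x choose j)))"
    unfolding binomial_det_def by (rule sum_PiE_det) simp
  also have "\<dots> = det (mat n n (\<lambda>(i, j). trapezoid_antidiff j (d (Suc i)) - trapezoid_antidiff j (d i)))"
    by (intro arg_cong[where f = det] cong_mat) (auto simp: w_def sum_trapezoid_choose lt)
  also have "\<dots> = 2 ^ n * binomial_det (Suc n) d"
    by (rule det_antidiff_differences)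
  finally show ?thesis .
qed

section \<open>Recursion over the longest row\<close>

lemma triangles_Suc_iff:
  "E \<in> triangles N (Suc n) \<longleftrightarrow>
    E \<in> extensional {..Suc n} \<and> E (Suc n) \<in> increasing_rows N (Suc n) \<and> interlaced n (E n) (E (Suc n))
    \<and> restrict E {..n} \<in> triangles N n"
  unfolding triangles_def PiE_iff by (auto simp: le_Suc_eq less_Suc_eq)

text \<open>The pair records the row \<open>e = E n\<close> next to the smaller triangle
  \<open>E\<close>, so that a sum over triangles can be split by the second longest row.\<close>

lemma triangles_Suc_bij:
  assumes d: "d \<in> increasing_rows N (Suc n)"
  shows "bij_betw (\<lambda>(e, E). E(Suc n := d))
    (SIGMA e:{e \<in> increasing_rows N n. interlaced n e d}. {E \<in> triangles N n. E n = e})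
    {E \<in> triangles N (Suc n). E (Suc n) = d}"
    (is "bij_betw ?f ?A ?B")
proof (rule bij_betwI[where g = "\<lambda>E. (E n, restrict E {..n})"])
  have restrict: "restrict (E(Suc n := d)) {..n} = E" if "E \<in> triangles N n" for E
  proof
    fix m
    have "E \<in> extensional {..n}"
      using that by (auto simp: triangles_def PiE_iff)
    from extensional_arb[OF this, of m] show "restrict (E(Suc n := d)) {..n} m = E m"
      by auto
  qed
  show "(\<lambda>E. (E n, restrict E {..n})) \<in> ?B \<rightarrow> ?A"
    by (auto simp: triangles_Suc_iff) (auto simp: triangles_def PiE_iff)
  show "?f \<in> ?A \<rightarrow> ?B"
  proof
    fix x assume "x \<in> ?A"
    then obtain E where E: "x = (E n, E)" "E \<in> triangles N n" "interlaced n (E n) d"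
      by auto
    have "E(Suc n := d) \<in> extensional {..Suc n}"
      using E(2) by (auto simp: triangles_def PiE_iff extensional_def)
    then show "?f x \<in> ?B"
      using E d restrict[OF E(2)] by (simp add: triangles_Suc_iff)
  qed
  show "(\<lambda>E. (E n, restrict E {..n})) (?f x) = x" if "x \<in> ?A" for x
    using that restrict by auto
  show "?f ((\<lambda>E. (E n, restrict E {..n})) E) = E" if "E \<in> ?B" for E
  proof
    fix m
    have "E \<in> extensional {..Suc n}" "E (Suc n) = d"
      using that by (auto simp: triangles_def PiE_iff)
    then show "?f ((\<lambda>E. (E n, restrict E {..n})) E) m = E m"
      using extensional_arb[of E "{..Suc n}" m] by (auto simp: le_Suc_eq)
  qed
qed

text \<open>Induction on \<open>n\<close>, removing the longest row: passing from length
  \<open>k\<close> to \<open>Suc k\<close> contributes the factor \<open>2 ^ k\<close> by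
  \<open>sum_interlaced\<close>.\<close>

lemma sum_triangles_bottom:
  assumes "d \<in> increasing_rows N n"
  shows "(\<Sum>E | E \<in> triangles N n \<and> E n = d. 2 ^ departures n E) = (\<Prod>k<n. 2 ^ k) * binomial_det n d"
  using assms
proof (induction n arbitrary: d)
  case 0
  have "{E. E \<in> triangles N 0 \<and> E 0 = d} = {restrict (\<lambda>_. d) {..0}}"
  proof (intro equalityI subsetI)
    fix E assume "E \<in> {E. E \<in> triangles N 0 \<and> E 0 = d}"
    then have E: "E \<in> extensional {..0}" "E 0 = d"
      by (simp_all add: triangles_def PiE_iff)
    have "E = restrict (\<lambda>_. d) {..0}"
      by (rule extensionalityI[OF E(1)]) (use E(2) in auto)
    then show "E \<in> {restrict (\<lambda>_. d) {..0}}" by simp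
  qed (use 0 in \<open>simp add: triangles_def PiE_iff\<close>)
  then show ?case
    by (simp add: departures_def binomial_det_def)
next
  case (Suc n)
  let ?R = "{e \<in> increasing_rows N n. interlaced n e d}" and ?T = "\<lambda>e. {E \<in> triangles N n. E n = e}"
  have "(\<Sum>E | E \<in> triangles N (Suc n) \<and> E (Suc n) = d. (2 :: int) ^ departures (Suc n) E)
      = (\<Sum>(e, E) \<in> Sigma ?R ?T. 2 ^ departures (Suc n) (E(Suc n := d)))"
    by (subst sum.reindex_bij_betw[OF triangles_Suc_bij[OF Suc.prems], symmetric]) (simp add: case_prod_unfold)
  also have "\<dots> = (\<Sum>(e, E) \<in> Sigma ?R ?T. 2 ^ card (e ` {..<n} - d ` {..<Suc n}) * 2 ^ departures n E)"
    by (rule sum.cong) (auto simp: departures_def power_add mult.commute)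
  also have "\<dots> = (\<Sum>e \<in> ?R. 2 ^ card (e ` {..<n} - d ` {..<Suc n}) * (\<Sum>E \<in> ?T e. 2 ^ departures n E))"
    by (subst sum.Sigma[symmetric]) (auto simp: finite_increasing_rows finite_triangles sum_distrib_left)
  also have "\<dots> = (\<Sum>e \<in> ?R. 2 ^ card (e ` {..<n} - d ` {..<Suc n}) * ((\<Prod>k<n. 2 ^ k) * binomial_det n e))"
    using Suc.IH by (intro sum.cong) auto
  also have "\<dots> = (\<Prod>k<n. 2 ^ k) * (\<Sum>e \<in> ?R. 2 ^ card (e ` {..<n} - d ` {..<Suc n}) * binomial_det n e)"
    by (simp only: sum_distrib_left mult.left_commute)
  also have "\<dots> = (\<Prod>k<Suc n. 2 ^ k) * binomial_det (Suc n) d"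
    by (simp add: sum_interlaced[OF Suc.prems])
  finally show ?case .
qed

text \<open>The condition \<open>E n i div 2 = i\<close> is both the diagonal condition of tableaux
  and the pairing condition of U-turn matrices, with letters and matrix rows numbered from
  0.\<close>

definition symplectic_triangles :: "nat \<Rightarrow> (nat \<Rightarrow> nat \<Rightarrow> nat) set" where
  "symplectic_triangles n = {E \<in> triangles (2 * n) n. \<forall>i<n. E n i div 2 = i}"

lemma sum_symplectic_triangles:
  "(\<Sum>E \<in> symplectic_triangles n. 2 ^ departures n E) = (2 :: int) ^ (n\<^sup>2)"
proof -
  \<comment> \<open>The possible longest rows. Such choices increase automatically, since the pairs
    are disjoint and in order.\<close>
  define D where "D = PiE {..<n} (\<lambda>i. {2 * i, Suc (2 * i)})"
  have div2: "x div 2 = i \<longleftrightarrow> x \<in> {2 * i, Suc (2 * i)}" for x i :: nat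
    unfolding insert_iff empty_iff by presburger
  have bound: "d i \<in> {2 * i, Suc (2 * i)}" if "d \<in> D" "i < n" for d i
    using PiE_mem[of d "{..<n}" _ i] that by (auto simp: D_def)
  have D_rows: "d \<in> increasing_rows (2 * n) n" if "d \<in> D" for d
  proof -
    have "d i < 2 * n" if "i < n" for i
      using bound[OF \<open>d \<in> D\<close> that] that by auto
    moreover have "d i < d j" if "i < j" "j < n" for i j
      using bound[OF \<open>d \<in> D\<close>, of i] bound[OF \<open>d \<in> D\<close>, of j] that by auto
    moreover have "d \<in> extensional {..<n}"
      using \<open>d \<in> D\<close> by (simp add: D_def PiE_iff)
    ultimately show ?thesis
      by (simp add: increasing_rows_def PiE_iff strict_mono_on_def)
  qed
  have "(\<Sum>E \<in> symplectic_triangles n. (2 :: int) ^ departures n E)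
      = (\<Sum>d \<in> D. \<Sum>E | E \<in> triangles (2 * n) n \<and> E n = d. 2 ^ departures n E)"
  proof -
    have eq: "symplectic_triangles n = {E \<in> triangles (2 * n) n. E n \<in> D}"
      by (auto simp: symplectic_triangles_def D_def PiE_iff div2 triangles_def increasing_rows_def)
    show ?thesis
      by (subst sum.group[of "symplectic_triangles n" D "\<lambda>E. E n", symmetric])
        (auto simp: eq finite_triangles D_def intro!: finite_PiE sum.cong)
  qed
  also have "\<dots> = (\<Prod>k<n. 2 ^ k) * (\<Sum>d \<in> D. binomial_det n d)"
    using D_rows by (auto simp: sum_distrib_left sum_triangles_bottom intro!: sum.cong)
  \<comment> \<open>Multilinearity with unit weights merges the two choices for each row.\<close>
  also have "(\<Sum>d \<in> D. binomial_det n d)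
      = det (mat n n (\<lambda>(i, j). int ((2 * i) choose j) + int (Suc (2 * i) choose j)))"
    using sum_PiE_det[of n "\<lambda>i. {2 * i, Suc (2 * i)}" "\<lambda>_ _. 1" "\<lambda>x j. int (x choose j)"]
    by (simp add: D_def binomial_det_def del: binomial_Suc_Suc)
  also have "\<dots> = (\<Prod>k<n. 2 ^ Suc k)"
    by (rule det_choose_double)
  \<comment> \<open>The exponents \<open>k\<close> and \<open>Suc k\<close> add up to 2k + 1, and
    the first \<open>n\<close> odd numbers sum to \<open>n\<^sup>2\<close>.\<close>
  also have "(\<Prod>k<n. 2 ^ k) * (\<Prod>k<n. 2 ^ Suc k) = (2 :: int) ^ (n\<^sup>2)"
    by (induction n) (auto simp: power2_eq_square power_add mult_ac)
  finally show ?thesis .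
qed

section \<open>Shifted tableaux\<close>

definition content :: "nat \<times> nat \<Rightarrow> nat" where
  "content b = snd b - fst b"

text \<open>Adjacent boxes lie on neighbouring diagonals; here each diagonal holds at most one box,
  and boxes on neighbouring diagonals are adjacent. Components are thus the maximal runs of
  consecutive contents, counted by their last contents.\<close>

lemma card_box_components:
  assumes "finite B"
    and shape: "\<And>b. b \<in> B \<Longrightarrow> fst b \<le> snd b"
    and inj: "inj_on content B"
    and adj: "\<And>b b'. b \<in> B \<Longrightarrow> b' \<in> B \<Longrightarrow> content b' = Suc (content b) \<Longrightarrow> box_adjacent b b'"
  shows "card (box_components B) = card {k \<in> content ` B. Suc k \<notin> content ` B}"
proof -
  define R where "R = {(b, b'). b \<in> B \<and> b' \<in> B \<and> box_adjacent b b'}"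
  define tops where "tops = {b \<in> B. Suc (content b) \<notin> content ` B}"
  have sym: "(b, b') \<in> R\<^sup>* \<Longrightarrow> (b', b) \<in> R\<^sup>*" for b b'
  proof -
    have "sym R"
      by (auto simp: sym_def R_def box_adjacent_def)
    then show "(b, b') \<in> R\<^sup>* \<Longrightarrow> (b', b) \<in> R\<^sup>*"
      by (rule symD[OF sym_rtrancl])
  qed
  \<comment> \<open>A walk changes the content by one at a time, so to rise above a top box it would
    have to visit the missing content \<open>Suc (content b)\<close>.\<close>
  have bound: "content b' \<le> content b" if b: "b \<in> tops" and "(b, b') \<in> R\<^sup>*" for b b'
    using that(2)
  proof induction
    case (step y z)
    then have yz: "y \<in> B" "z \<in> B" "box_adjacent y z"
      by (auto simp: R_def)
    then have "content z = Suc (content y) \<or> content y = Suc (content z)"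
      using shape[of y] shape[of z] by (auto simp: box_adjacent_def content_def)
    moreover have "content z \<noteq> Suc (content b)"
      using b imageI[OF yz(2), of content] by (auto simp: tops_def)
    ultimately show ?case
      using step.IH by auto
  qed simp
  \<comment> \<open>Climbing to the box with the next content ends at a top, by induction on the
    distance to the maximal content.\<close>
  have top: "\<exists>t \<in> tops. (b, t) \<in> R\<^sup>*" if "b \<in> B" for b
    using that
  proof (induction "Max (content ` B) - content b" arbitrary: b rule: less_induct)
    case less
    show ?case
    proof (cases "b \<in> tops")
      case False
      then obtain b' where b': "b' \<in> B" "content b' = Suc (content b)"
        using less.prems by (auto simp: tops_def)
      have "content b' \<le> Max (content ` B)"
        using b'(1) \<open>finite B\<close> by simp
      then have "\<exists>t \<in> tops. (b', t) \<in> R\<^sup>*"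
        using b' by (intro less.hyps) auto
      moreover have "(b, b') \<in> R"
        using adj b' less.prems by (auto simp: R_def)
      ultimately show ?thesis
        by (meson converse_rtrancl_into_rtrancl)
    qed auto
  qed
  have "bij_betw (\<lambda>b. R\<^sup>* `` {b}) tops (box_components B)"
    unfolding bij_betw_def
  proof
    show "inj_on (\<lambda>b. R\<^sup>* `` {b}) tops"
    proof (rule inj_onI)
      fix b b' assume b: "b \<in> tops" "b' \<in> tops" "R\<^sup>* `` {b} = R\<^sup>* `` {b'}"
      then have "(b, b') \<in> R\<^sup>*" by blast
      then have "content b = content b'"
        using bound[of b b'] bound[of b' b] b sym by (meson le_antisym)
      then show "b = b'"
        using inj b by (auto simp: tops_def inj_on_def)
    qed
    show "(\<lambda>b. R\<^sup>* `` {b}) ` tops = box_components B"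
    proof (intro equalityI subsetI)
      fix X assume "X \<in> box_components B"
      then obtain b where b: "b \<in> B" "X = R\<^sup>* `` {b}"
        by (auto simp: box_components_def quotient_def R_def)
      obtain t where t: "t \<in> tops" "(b, t) \<in> R\<^sup>*"
        using top[OF b(1)] by blast
      have "R\<^sup>* `` {b} = R\<^sup>* `` {t}"
        using t(2) sym[OF t(2)] by (auto intro: rtrancl_trans)
      then show "X \<in> (\<lambda>b. R\<^sup>* `` {b}) ` tops"
        using b t by blast
    qed (auto simp: box_components_def quotient_def R_def tops_def)
  qed
  then have "card (box_components B) = card tops"
    by (simp add: bij_betw_same_card)
  also have "\<dots> = card (content ` tops)"
    by (rule card_image[symmetric]) (rule inj_on_subset[OF inj], auto simp: tops_def)
  also have "content ` tops = {k \<in> content ` B. Suc k \<notin> content ` B}"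
    by (auto simp: tops_def)
  finally show ?thesis .
qed

section \<open>Letters as numbers\<close>

text \<open>The least letter, \<open>Barred 1\<close>, has rank 2. The shift identifies
  \<open>letters n\<close> with \<open>{..<2 * n}\<close>, and \<open>Barred (Suc i)\<close>,
  \<open>Unbarred (Suc i)\<close> with \<open>2 * i\<close>, \<open>Suc (2 * i)\<close>.\<close>

definition letter_index :: "letter \<Rightarrow> nat" where
  "letter_index x = letter_rank x - 2"

definition letter_at :: "nat \<Rightarrow> letter" where
  "letter_at r = (if even r then Barred (Suc (r div 2)) else Unbarred (Suc (r div 2)))"

lemma letter_index_at [simp]: "letter_index (letter_at r) = r"
  by (auto simp: letter_index_def letter_at_def)

lemma letter_at_index [simp]: "x \<in> letters n \<Longrightarrow> letter_at (letter_index x) = x"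
  by (cases x) (auto simp: letter_index_def letter_at_def letters_def image_iff)

lemma letter_index_less: "x \<in> letters n \<Longrightarrow> letter_index x < 2 * n"
  by (cases x) (auto simp: letter_index_def letters_def)

lemma letter_at_in_letters: "r < 2 * n \<Longrightarrow> letter_at r \<in> letters n"
  by (auto simp: letter_at_def letters_def)

lemma less_eq_letter_at_iff: "letter_at r \<le> letter_at s \<longleftrightarrow> r \<le> s"
  by (auto simp: less_eq_letter_def letter_at_def; presburger)

lemma less_letter_at_iff: "letter_at r < letter_at s \<longleftrightarrow> r < s"
  using less_eq_letter_at_iff[of s r] by (simp add: not_le[symmetric])

lemma letter_index_div_2:
  "x \<in> letters n \<Longrightarrow> letter_index x div 2 = i \<longleftrightarrow> x \<in> {Unbarred (Suc i), Barred (Suc i)}"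
  by (cases x) (auto simp: letter_index_def letters_def)

lemma letter_index_mono:
  assumes "x \<in> letters n" "y \<in> letters n"
  shows "letter_index x \<le> letter_index y \<longleftrightarrow> x \<le> y" "letter_index x < letter_index y \<longleftrightarrow> x < y"
  using assms less_eq_letter_at_iff[of "letter_index x" "letter_index y"]
    less_letter_at_iff[of "letter_index x" "letter_index y"] by auto

lemma inj_on_letter_index: "inj_on letter_index (letters n)"
  by (metis inj_onI letter_at_index)

section \<open>Tableaux as triangles\<close>

text \<open>Row \<open>m\<close> is the diagonal of content \<open>n - m\<close>, which has
  \<open>m\<close> boxes; its entries are numbered from 0, the boxes from 1.\<close>

definition triangle_of_tableau :: "nat \<Rightarrow> (nat \<times> nat \<Rightarrow> letter) \<Rightarrow> nat \<Rightarrow> nat \<Rightarrow> nat" where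
  "triangle_of_tableau n T =
    (\<lambda>m\<in>{..n}. \<lambda>i\<in>{..<m}. letter_index (T (Suc i, Suc i + (n - m))))"

definition tableau_of_triangle :: "nat \<Rightarrow> (nat \<Rightarrow> nat \<Rightarrow> nat) \<Rightarrow> nat \<times> nat \<Rightarrow> letter" where
  "tableau_of_triangle n E = (\<lambda>(i, j)\<in>shifted_shape n. letter_at (E (n - (j - i)) (i - 1)))"

lemma shifted_tableauxD:
  assumes "T \<in> shifted_tableaux n"
  shows "1 \<le> i \<Longrightarrow> i \<le> j \<Longrightarrow> j \<le> n \<Longrightarrow> T (i, j) \<in> letters n"
    and "1 \<le> i \<Longrightarrow> i \<le> n \<Longrightarrow> T (i, i) \<in> {Unbarred i, Barred i}"
    and "1 \<le> i \<Longrightarrow> i \<le> j \<Longrightarrow> Suc j \<le> n \<Longrightarrow> T (i, j) \<le> T (i, Suc j)"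
    and "1 \<le> i \<Longrightarrow> Suc i \<le> j \<Longrightarrow> j \<le> n \<Longrightarrow> T (i, j) \<le> T (Suc i, j)"
    and "1 \<le> i \<Longrightarrow> i \<le> j \<Longrightarrow> Suc j \<le> n \<Longrightarrow> T (i, j) < T (Suc i, Suc j)"
    and "T \<in> extensional (shifted_shape n)"
  using assms unfolding shifted_tableaux_def shifted_shape_def by (auto simp: PiE_iff)

text \<open>Strictness down the diagonals makes the rows increase, weak increase along rows and down
  columns gives the two halves of interlacing, and the main diagonal is the longest row.\<close>

lemma triangle_of_tableau_in:
  assumes T: "T \<in> shifted_tableaux n"
  shows "triangle_of_tableau n T \<in> symplectic_triangles n"
proof -
  let ?E = "triangle_of_tableau n T"
  have E: "?E m i = letter_index (T (Suc i, Suc i + (n - m)))" if "m \<le> n" "i < m" for m i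
    using that by (simp add: triangle_of_tableau_def)
  have L: "T (Suc i, Suc i + (n - m)) \<in> letters n" if "m \<le> n" "i < m" for m i
    using that by (intro shifted_tableauxD(1)[OF T]) auto
  have "?E m \<in> increasing_rows (2 * n) m" if m: "m \<le> n" for m
  proof (rule increasing_rowsI)
    show "?E m i < 2 * n" if "i < m" for i
      using letter_index_less[OF L[OF m that]] by (simp add: E m that)
    show "?E m i < ?E m (Suc i)" if "Suc i < m" for i
    proof -
      have "T (Suc i, Suc i + (n - m)) < T (Suc (Suc i), Suc (Suc i + (n - m)))"
        using m that by (intro shifted_tableauxD(5)[OF T]) auto
      then show ?thesis
        using m that L[of m i] L[of m "Suc i"] by (simp add: E letter_index_mono)
    qed
  qed (use m in \<open>auto simp: triangle_of_tableau_def\<close>)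
  moreover have "interlaced m (?E m) (?E (Suc m))" if m: "m < n" for m
    unfolding interlaced_def
  proof (intro allI impI conjI)
    fix i assume i: "i < m"
    have nm: "n - m = Suc (n - Suc m)"
      using m by simp
    have "T (Suc i, Suc i + (n - Suc m)) \<le> T (Suc i, Suc (Suc i + (n - Suc m)))"
      using m i by (intro shifted_tableauxD(3)[OF T]) auto
    then show "?E (Suc m) i \<le> ?E m i"
      using m i L[of m i] L[of "Suc m" i] by (simp add: E letter_index_mono nm)
    have "T (Suc i, Suc i + (n - m)) \<le> T (Suc (Suc i), Suc i + (n - m))"
      using m i by (intro shifted_tableauxD(4)[OF T]) auto
    then show "?E m i \<le> ?E (Suc m) (Suc i)"
      using m i L[of m i] L[of "Suc m" "Suc i"] by (simp add: E letter_index_mono nm)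
  qed
  moreover have "?E n i div 2 = i" if i: "i < n" for i
    using shifted_tableauxD(2)[OF T, of "Suc i"] L[of n i] i by (simp add: E letter_index_div_2)
  ultimately show ?thesis
    by (auto simp: symplectic_triangles_def triangles_def PiE_iff triangle_of_tableau_def[of n T])
qed

text \<open>The same translation of conditions, read in the other direction.\<close>

lemma tableau_of_triangle_in:
  assumes E: "E \<in> symplectic_triangles n"
  shows "tableau_of_triangle n E \<in> shifted_tableaux n"
proof -
  have tri: "E \<in> triangles (2 * n) n" and diag: "\<And>i. i < n \<Longrightarrow> E n i div 2 = i"
    using E by (auto simp: symplectic_triangles_def)
  let ?T = "tableau_of_triangle n E"
  have T: "?T (i, j) = letter_at (E (n - (j - i)) (i - 1))" if "1 \<le> i" "i \<le> j" "j \<le> n" for i j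
    using that by (simp add: tableau_of_triangle_def shifted_shape_def)
  have row: "E (n - k) \<in> increasing_rows (2 * n) (n - k)" for k
    by (rule trianglesD(1)[OF tri]) simp
  have L: "?T (i, j) \<in> letters n" if "1 \<le> i" "i \<le> j" "j \<le> n" for i j
  proof -
    have "E (n - (j - i)) (i - 1) < 2 * n"
      using that by (intro increasing_rowsD(1)[OF row]) auto
    then show ?thesis
      using that by (simp add: T letter_at_in_letters)
  qed
  have "?T (i, i) \<in> {Unbarred i, Barred i}" if "1 \<le> i" "i \<le> n" for i
  proof -
    have "letter_index (?T (i, i)) div 2 = i - 1"
      using diag[of "i - 1"] that by (simp add: T)
    then show ?thesis
      using L[of i i] that by (simp add: letter_index_div_2)
  qed
  moreover have "?T (i, j) \<le> ?T (i, Suc j)" if "1 \<le> i" "i \<le> j" "Suc j \<le> n" for i j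
  proof -
    have "E (Suc (n - Suc (j - i))) (i - 1) \<le> E (n - Suc (j - i)) (i - 1)"
      using that by (intro trianglesD(2)[OF tri]) auto
    moreover have "Suc (n - Suc (j - i)) = n - (j - i)" "Suc j - i = Suc (j - i)"
      using that by auto
    ultimately show ?thesis
      using that by (simp add: T less_eq_letter_at_iff)
  qed
  moreover have "?T (i, j) \<le> ?T (Suc i, j)" if "1 \<le> i" "Suc i \<le> j" "j \<le> n" for i j
  proof -
    have "E (n - (j - i)) (i - 1) \<le> E (Suc (n - (j - i))) (Suc (i - 1))"
      using that by (intro trianglesD(3)[OF tri]) auto
    moreover have "Suc (n - (j - i)) = n - (j - Suc i)" "Suc (i - 1) = i"
      using that by auto
    ultimately show ?thesis
      using that by (simp add: T less_eq_letter_at_iff)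
  qed
  moreover have "?T (i, j) < ?T (Suc i, Suc j)" if "1 \<le> i" "i \<le> j" "Suc j \<le> n" for i j
  proof -
    have "E (n - (j - i)) (i - 1) < E (n - (j - i)) i"
      using that by (intro increasing_rowsD(2)[OF row]) auto
    then show ?thesis
      using that by (simp add: T less_letter_at_iff)
  qed
  moreover have "?T \<in> shifted_shape n \<rightarrow>\<^sub>E letters n"
    using L by (auto simp: PiE_iff shifted_shape_def tableau_of_triangle_def)
  ultimately show ?thesis
    unfolding shifted_tableaux_def by (auto simp: shifted_shape_def)
qed

lemma bij_betw_triangle_of_tableau:
  "bij_betw (triangle_of_tableau n) (shifted_tableaux n) (symplectic_triangles n)"
proof (rule bij_betwI[where g = "tableau_of_triangle n"])
  show "tableau_of_triangle n (triangle_of_tableau n T) = T" if T: "T \<in> shifted_tableaux n" for T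
  proof (rule extensionalityI[where A = "shifted_shape n"])
    fix b assume "b \<in> shifted_shape n"
    then obtain i j where b: "b = (i, j)" "1 \<le> i" "i \<le> j" "j \<le> n"
      by (auto simp: shifted_shape_def)
    then have "Suc (i - 1) = i" "i + (n - (n - (j - i))) = j" "i - 1 < n - (j - i)"
      by auto
    then show "tableau_of_triangle n (triangle_of_tableau n T) b = T b"
      using b letter_at_index[OF shifted_tableauxD(1)[OF T, of i j]]
      by (simp add: tableau_of_triangle_def triangle_of_tableau_def shifted_shape_def)
  qed (use shifted_tableauxD(6)[OF T] in \<open>auto simp: tableau_of_triangle_def\<close>)
  show "triangle_of_tableau n (tableau_of_triangle n E) = E" if E: "E \<in> symplectic_triangles n" for E
  proof (rule extensionalityI[where A = "{..n}"])
    have tri: "E \<in> triangles (2 * n) n"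
      using E by (auto simp: symplectic_triangles_def)
    show "E \<in> extensional {..n}"
      by (rule trianglesD(4)[OF tri])
    fix m assume m: "m \<in> {..n}"
    show "triangle_of_tableau n (tableau_of_triangle n E) m = E m"
    proof (rule extensionalityI[where A = "{..<m}"])
      show "E m \<in> extensional {..<m}"
        using trianglesD(1)[OF tri, of m] m by (simp add: increasing_rows_def PiE_iff)
      show "triangle_of_tableau n (tableau_of_triangle n E) m \<in> extensional {..<m}"
        using m by (simp add: triangle_of_tableau_def)
      show "triangle_of_tableau n (tableau_of_triangle n E) m i = E m i" if "i \<in> {..<m}" for i
      proof -
        have "Suc (i + n - m) \<le> n"
          using that m by auto
        then show ?thesis
          using that m by (simp add: triangle_of_tableau_def tableau_of_triangle_def shifted_shape_def)
      qed
    qed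
  qed (simp add: triangle_of_tableau_def)
qed (use triangle_of_tableau_in tableau_of_triangle_in in auto)

text \<open>A component of a letter is counted at the diagonal that contains the letter while the
  next diagonal does not. Exchanging the sums counts, for each row of the triangle, its entries
  missing from the next shorter row. As the lengths differ by one, this exceeds by one the number of
  entries of the shorter row missing from the longer, and \<open>n\<close> pairs of rows give the
  extra \<open>n\<close>.\<close>

lemma str_eq_departures:
  assumes T: "T \<in> shifted_tableaux n"
  shows "str n T = departures n (triangle_of_tableau n T) + n"
proof -
  define E where "E = triangle_of_tableau n T"
  have E: "E m i = letter_index (T (Suc i, Suc i + (n - m)))" if "m \<le> n" "i < m" for m i
    using that by (simp add: E_def triangle_of_tableau_def)
  have tri: "E \<in> triangles (2 * n) n"
    using triangle_of_tableau_in[OF T] by (simp add: E_def symplectic_triangles_def)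
  note row = trianglesD(1)[OF tri]
  define B where "B c = {b \<in> shifted_shape n. T b = c}" for c
  have box: "\<exists>i k. b = (Suc i, Suc i + k) \<and> k < n \<and> i < n - k" if "b \<in> shifted_shape n" for b
  proof -
    obtain x y where b: "b = (x, y)"
      by (cases b)
    then have "1 \<le> x" "x \<le> y" "y \<le> n"
      using that by (auto simp: shifted_shape_def)
    then show ?thesis
      unfolding b by (intro exI[of _ "x - 1"] exI[of _ "y - x"]) auto
  qed
  have ET: "E (n - k) i = letter_index (T (Suc i, Suc i + k))" if "k < n" "i < n - k" for k i
    using E[of "n - k" i] that by simp
  have comp: "card (box_components (B c)) = card {k \<in> content ` B c. Suc k \<notin> content ` B c}" for c
  proof (rule card_box_components)
    have "shifted_shape n \<subseteq> {..n} \<times> {..n}"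
      by (auto simp: shifted_shape_def)
    then show "finite (B c)"
      unfolding B_def by (auto intro: finite_subset)
    show "fst b \<le> snd b" if "b \<in> B c" for b
      using that by (auto simp: B_def shifted_shape_def)
    show "inj_on content (B c)"
    proof (rule inj_onI)
      fix b b' assume b: "b \<in> B c" "b' \<in> B c" "content b = content b'"
      then obtain i k i' where ik: "b = (Suc i, Suc i + k)" "b' = (Suc i', Suc i' + k)"
        "k < n" "i < n - k" "i' < n - k"
        using box[of b] box[of b'] by (auto simp: B_def content_def)
      then have "E (n - k) i = E (n - k) i'"
        using b by (simp add: ET B_def)
      then have "i = i'"
        using increasing_rowsD(4)[OF row, of "n - k"] ik(4,5) by (auto simp: inj_on_def)
      then show "b = b'"
        by (simp add: ik)
    qed
    show "box_adjacent b b'" if b: "b \<in> B c" "b' \<in> B c" "content b' = Suc (content b)" for b b'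
    proof -
      obtain i k i' where ik: "b = (Suc i, Suc i + k)" "b' = (Suc i', Suc i' + Suc k)"
        "Suc k < n" "i < n - k" "i' < n - Suc k"
        using box[of b] box[of b'] b by (auto simp: B_def content_def)
      define m where "m = n - Suc k"
      have m: "n - k = Suc m" "m < n" "i' < m" "i < Suc m"
        using ik by (auto simp: m_def)
      have "E (Suc m) i = E m i'"
        using b ik ET[of k i] ET[of "Suc k" i'] m by (simp add: B_def flip: m_def)
      \<comment> \<open>Interlacing leaves two positions for the equal entry in the longer row:
        \<open>i'\<close>, with \<open>b\<close> left of \<open>b'\<close>, and
        \<open>Suc i'\<close>, with \<open>b\<close> below \<open>b'\<close>.\<close>
      then have "E (Suc m) i' \<le> E (Suc m) i" "E (Suc m) i \<le> E (Suc m) (Suc i')"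
        using trianglesD(2,3)[OF tri m(2) m(3)] by auto
      then have "i' \<le> i" "i \<le> Suc i'"
        using increasing_rows_less_iff[OF row[of "Suc m"], of i i']
          increasing_rows_less_iff[OF row[of "Suc m"], of "Suc i'" i] m
        by (auto simp flip: not_less)
      then show ?thesis
        by (auto simp: ik box_adjacent_def le_Suc_eq)
    qed
  qed
  \<comment> \<open>The letters on the diagonal of content \<open>k\<close>; under
    \<open>letter_index\<close> they become the entries of row \<open>n - k\<close>.\<close>
  define D where "D k = {c \<in> letters n. k \<in> content ` B c}" for k
  have D: "letter_index ` D k = E (n - k) ` {..<n - k}" for k
  proof (intro equalityI subsetI)
    fix r assume "r \<in> letter_index ` D k"
    then obtain c b where cb: "r = letter_index c" "b \<in> B c" "k = content b"
      by (auto simp: D_def)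
    then show "r \<in> E (n - k) ` {..<n - k}"
      using box[of b] by (auto simp: B_def content_def ET)
  next
    fix r assume "r \<in> E (n - k) ` {..<n - k}"
    then obtain i where i: "i < n - k" "r = E (n - k) i" by auto
    let ?b = "(Suc i, Suc i + k)"
    have "?b \<in> B (T ?b)" "T ?b \<in> letters n"
      using i shifted_tableauxD(1)[OF T, of "Suc i" "Suc i + k"] by (auto simp: B_def shifted_shape_def)
    moreover have "content ?b = k"
      by (simp add: content_def)
    ultimately have "T ?b \<in> D k"
      unfolding D_def by force
    moreover have "r = letter_index (T ?b)"
      using i ET[of k i] by simp
    ultimately show "r \<in> letter_index ` D k" by blast
  qed
  have fin: "finite (letters n)"
    by (simp add: letters_def)
  have "str n T = (\<Sum>c \<in> letters n. card {k \<in> content ` B c. Suc k \<notin> content ` B c})"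
    by (simp add: str_def comp flip: B_def)
  also have "\<dots> = (\<Sum>c \<in> letters n. \<Sum>k<n. if c \<in> D k - D (Suc k) then 1 else 0)"
  proof (rule sum.cong)
    fix c assume c: "c \<in> letters n"
    have "{k \<in> content ` B c. Suc k \<notin> content ` B c} = {k \<in> {..<n}. c \<in> D k - D (Suc k)}"
      using c box by (auto simp: D_def B_def content_def shifted_shape_def)
    then show "card {k \<in> content ` B c. Suc k \<notin> content ` B c} = (\<Sum>k<n. if c \<in> D k - D (Suc k) then 1 else 0)"
      by (simp add: sum.If_cases Int_def)
  qed simp
  also have "\<dots> = (\<Sum>k<n. card (D k - D (Suc k)))"
  proof (subst sum.swap, rule sum.cong)
    fix k
    have "letters n \<inter> {c. c \<in> D k - D (Suc k)} = D k - D (Suc k)"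
      by (auto simp: D_def)
    then show "(\<Sum>c \<in> letters n. if c \<in> D k - D (Suc k) then 1 else 0) = card (D k - D (Suc k))"
      using fin by (simp add: sum.If_cases)
  qed simp
  also have "\<dots> = (\<Sum>k<n. card (E (n - k) ` {..<n - k} - E (n - Suc k) ` {..<n - Suc k}))"
  proof (rule sum.cong)
    fix k
    have "card (D k - D (Suc k)) = card (letter_index ` (D k - D (Suc k)))"
      by (rule card_image[symmetric], rule inj_on_subset[OF inj_on_letter_index[of n]])
        (auto simp: D_def)
    also have "letter_index ` (D k - D (Suc k)) = letter_index ` D k - letter_index ` D (Suc k)"
      by (rule inj_on_image_set_diff[OF inj_on_letter_index[of n]]) (auto simp: D_def)
    finally show "card (D k - D (Suc k)) = card (E (n - k) ` {..<n - k} - E (n - Suc k) ` {..<n - Suc k})"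
      by (simp add: D)
  qed simp
  \<comment> \<open>Writing \<open>n - k\<close> as a successor prepares the reversal of the sum,
    with \<open>m = n - Suc k\<close>.\<close>
  also have "\<dots> = (\<Sum>k<n. card (E (Suc (n - Suc k)) ` {..<Suc (n - Suc k)} - E (n - Suc k) ` {..<n - Suc k}))"
    by (intro sum.cong refl) (simp add: Suc_diff_Suc)
  also have "\<dots> = (\<Sum>m<n. card (E (Suc m) ` {..<Suc m} - E m ` {..<m}))"
    by (rule sum.nat_diff_reindex)
  \<comment> \<open>The two sets have \<open>Suc m\<close> and \<open>m\<close> elements and one
    common intersection, so their differences in the two directions differ by one in size.\<close>
  also have "\<dots> = (\<Sum>m<n. card (E m ` {..<m} - E (Suc m) ` {..<Suc m}) + 1)"
  proof (rule sum.cong)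
    fix m assume "m \<in> {..<n}"
    then have "card (E m ` {..<m}) = m" "card (E (Suc m) ` {..<Suc m}) = Suc m"
      using increasing_rowsD(4)[OF row, of m] increasing_rowsD(4)[OF row, of "Suc m"]
      by (simp_all add: card_image del: image_Suc_lessThan)
    moreover have "card (E m ` {..<m} \<inter> E (Suc m) ` {..<Suc m}) \<le> card (E m ` {..<m})"
      by (rule card_mono) auto
    ultimately show "card (E (Suc m) ` {..<Suc m} - E m ` {..<m}) = card (E m ` {..<m} - E (Suc m) ` {..<Suc m}) + 1"
      by (simp add: card_Diff_subset_Int Int_commute)
  qed simp
  also have "\<dots> = departures n E + n"
    unfolding sum.distrib departures_def by simp
  finally show ?thesis
    by (simp add: E_def)
qed

text \<open>The exponent is a number of departures, hence nonnegative, and the integer power is an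
  ordinary one.\<close>

lemma sum_shifted_tableaux:
  "(\<Sum>T \<in> shifted_tableaux n. (2 :: real) powi (int (str n T) - int n)) = 2 ^ (n\<^sup>2)"
proof -
  have "(\<Sum>T \<in> shifted_tableaux n. (2 :: real) powi (int (str n T) - int n))
      = (\<Sum>T \<in> shifted_tableaux n. 2 ^ departures n (triangle_of_tableau n T))"
    by (rule sum.cong) (auto simp: str_eq_departures power_int_def)
  also have "\<dots> = (\<Sum>E \<in> symplectic_triangles n. 2 ^ departures n E)"
    by (rule sum.reindex_bij_betw[OF bij_betw_triangle_of_tableau])
  also have "\<dots> = of_int (\<Sum>E \<in> symplectic_triangles n. 2 ^ departures n E)"
    by simp
  also have "\<dots> = 2 ^ (n\<^sup>2)"
    by (subst sum_symplectic_triangles) simp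
  finally show ?thesis .
qed

section \<open>U-turn matrices\<close>

text \<open>The values at least \<open>j\<close> stand at the end of the sequence, so their number
  decides whether position \<open>i\<close> is among them. This turns comparisons of entries into
  tail counts, which the column sums of a matrix express.\<close>

lemma increasing_rows_le_iff:
  assumes e: "e \<in> increasing_rows N m" and i: "i < m"
  shows "j \<le> e i \<longleftrightarrow> m - i \<le> card (e ` {..<m} \<inter> {j..})"
proof
  have inj: "inj_on e {a..<m}" for a
    by (rule inj_on_subset[OF increasing_rowsD(4)[OF e]]) auto
  assume "j \<le> e i"
  then have "e ` {i..<m} \<subseteq> e ` {..<m} \<inter> {j..}"
    using increasing_rowsD(2)[OF e, of i] by (fastforce simp: le_less)
  from card_mono[OF _ this] show "m - i \<le> card (e ` {..<m} \<inter> {j..})"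
    using inj by (simp add: card_image)
next
  assume *: "m - i \<le> card (e ` {..<m} \<inter> {j..})"
  show "j \<le> e i"
  proof (rule ccontr)
    assume "\<not> j \<le> e i"
    have "e ` {..<m} \<inter> {j..} \<subseteq> e ` {Suc i..<m}"
    proof
      fix x assume "x \<in> e ` {..<m} \<inter> {j..}"
      then obtain k where k: "k < m" "x = e k" "j \<le> e k" by auto
      then have "i < k"
        using \<open>\<not> j \<le> e i\<close> increasing_rows_less_iff[OF e i k(1)] by auto
      then show "x \<in> e ` {Suc i..<m}"
        using k by auto
    qed
    from card_mono[OF _ this] have "card (e ` {..<m} \<inter> {j..}) \<le> card (e ` {Suc i..<m})"
      by simp
    also have "\<dots> \<le> m - Suc i"
      using card_image_le[of "{Suc i..<m}" e] by simp
    finally show False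
      using * i by simp
  qed
qed

text \<open>The tail counts depend only on the set of values, and they determine every
  entry.\<close>

lemma increasing_rows_eqI:
  assumes "e \<in> increasing_rows N m" "d \<in> increasing_rows N m" "e ` {..<m} = d ` {..<m}"
  shows "e = d"
proof
  fix i
  show "e i = d i"
  proof (cases "i < m")
    case True
    then have "j \<le> e i \<longleftrightarrow> j \<le> d i" for j
      using increasing_rows_le_iff[OF assms(1)] increasing_rows_le_iff[OF assms(2)] assms(3) by simp
    then show ?thesis
      by (meson le_antisym le_refl)
  qed (simp add: increasing_rowsD(3)[OF assms(1)] increasing_rowsD(3)[OF assms(2)])
qed

lemma card_increasing_rows:
  "e \<in> increasing_rows N m \<Longrightarrow> card (e ` {..<m}) = m"
  by (simp add: card_image increasing_rowsD(4))

lemma ex_increasing_row: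
  assumes "X \<subseteq> {..<N}" "card X = m"
  shows "\<exists>e \<in> increasing_rows N m. e ` {..<m} = X"
proof -
  have fin: "finite X"
    using assms(1) finite_subset by blast
  let ?xs = "sorted_list_of_set X"
  let ?e = "restrict (nth ?xs) {..<m}"
  have len: "length ?xs = m" and set: "set ?xs = X"
    using fin assms(2) by auto
  have "?e ` {..<m} = X"
    using set len by (auto simp: set_conv_nth)
  moreover have "?e i < ?e j" if "i < j" "j < m" for i j
    using sorted_wrt_nth_less[OF strict_sorted_list_of_set, of i j X] that len by simp
  moreover have "?e i < N" if "i < m" for i
    using set len assms(1) that nth_mem[of i ?xs] by auto
  ultimately show ?thesis
    by (intro bexI[of _ ?e]) (auto simp: increasing_rows_def strict_mono_on_def)
qed

text \<open>Of the two halves of interlacing, \<open>d i \<le> e i\<close> bounds the tail counts of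
  \<open>d\<close> by those of \<open>e\<close> plus 1, and \<open>e i \<le> d (Suc i)\<close>
  bounds those of \<open>e\<close> by those of \<open>d\<close>. In this form interlacing is the
  condition on the column tails of a U-turn matrix.\<close>

lemma interlaced_iff_card:
  assumes e: "e \<in> increasing_rows N m" and d: "d \<in> increasing_rows N (Suc m)"
  shows "interlaced m e d \<longleftrightarrow> (\<forall>j<N.
    int (card (d ` {..<Suc m} \<inter> {j..})) - int (card (e ` {..<m} \<inter> {j..})) \<in> {0, 1})"
proof
  assume int: "interlaced m e d"
  show "\<forall>j<N. int (card (d ` {..<Suc m} \<inter> {j..})) - int (card (e ` {..<m} \<inter> {j..})) \<in> {0, 1}"
  proof (intro allI impI)
    fix j
    define a b where "a = card (d ` {..<Suc m} \<inter> {j..})" and "b = card (e ` {..<m} \<inter> {j..})"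
    have "a \<le> card (d ` {..<Suc m})" "b \<le> card (e ` {..<m})"
      unfolding a_def b_def by (auto intro: card_mono)
    then have ab: "a \<le> Suc m" "b \<le> m"
      using card_increasing_rows[OF e] card_increasing_rows[OF d] by auto
    have "b \<le> a"
    proof (cases "b = 0")
      case False
      \<comment> \<open>The first position of \<open>e\<close> whose entry is at least
        \<open>j\<close>.\<close>
      define i where "i = m - b"
      have i: "i < m" "b = m - i"
        using False ab by (auto simp: i_def)
      then have "j \<le> e i"
        using increasing_rows_le_iff[OF e, of i j] by (simp add: b_def)
      also have "e i \<le> d (Suc i)"
        using int i by (simp add: interlaced_def)
      finally show ?thesis
        using increasing_rows_le_iff[OF d, of "Suc i" j] i by (simp add: a_def)
    qed simp
    moreover have "a \<le> b + 1"
    proof (cases "a \<le> 1")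
      case False
      define i where "i = Suc m - a"
      have i: "i < m" "a = Suc m - i"
        using False ab by (auto simp: i_def)
      then have "j \<le> d i"
        using increasing_rows_le_iff[OF d, of i j] by (simp add: a_def)
      also have "d i \<le> e i"
        using int i by (simp add: interlaced_def)
      finally show ?thesis
        using increasing_rows_le_iff[OF e, of i j] i by (simp add: b_def)
    qed simp
    ultimately show "int a - int b \<in> {0, 1}" by auto
  qed
next
  assume *: "\<forall>j<N. int (card (d ` {..<Suc m} \<inter> {j..})) - int (card (e ` {..<m} \<inter> {j..})) \<in> {0, 1}"
  have le: "card (e ` {..<m} \<inter> {j..}) \<le> card (d ` {..<Suc m} \<inter> {j..})"
    and ge: "card (d ` {..<Suc m} \<inter> {j..}) \<le> card (e ` {..<m} \<inter> {j..}) + 1" if "j < N" for j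
    using * that by force+
  show "interlaced m e d"
    unfolding interlaced_def
  proof (intro allI impI conjI)
    fix i assume i: "i < m"
    have "d i < N" "e i < N"
      using i increasing_rowsD(1)[OF d] increasing_rowsD(1)[OF e] by auto
    show "d i \<le> e i"
      using increasing_rows_le_iff[OF d, of i "d i"] increasing_rows_le_iff[OF e i, of "d i"]
        ge[OF \<open>d i < N\<close>] i by auto
    show "e i \<le> d (Suc i)"
      using increasing_rows_le_iff[OF d, of "Suc i" "e i"] increasing_rows_le_iff[OF e i, of "e i"]
        le[OF \<open>e i < N\<close>] i by auto
  qed
qed

lemma increasing_rows_self:
  assumes g: "g \<in> increasing_rows n n" and i: "i < n"
  shows "g i = i"
proof -
  have "g ` {..<n} = {..<n}"
    by (rule card_subset_eq) (use increasing_rowsD(1)[OF g] card_increasing_rows[OF g] in auto)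
  moreover have "{..<n} \<inter> {j..} = {j..<n}" for j
    by auto
  ultimately have "j \<le> g i \<longleftrightarrow> n - i \<le> n - j" for j
    using increasing_rows_le_iff[OF g i, of j] by simp
  from this[of i] this[of "g i"] show ?thesis
    using i by auto
qed

text \<open>For the converse direction: if no pair is used twice, halving keeps the sequence
  strictly increasing, and \<open>n\<close> increasing values below \<open>n\<close> form the
  identity.\<close>

lemma increasing_rows_div_2_iff:
  assumes d: "d \<in> increasing_rows (2 * n) n"
  shows "(\<forall>i<n. d i div 2 = i) \<longleftrightarrow>
    (\<forall>i<n. of_bool (2 * i \<in> d ` {..<n}) + of_bool (Suc (2 * i) \<in> d ` {..<n}) = (1 :: int))"
proof
  assume *: "\<forall>i<n. d i div 2 = i"
  show "\<forall>i<n. of_bool (2 * i \<in> d ` {..<n}) + of_bool (Suc (2 * i) \<in> d ` {..<n}) = (1 :: int)"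
  proof (intro allI impI)
    fix i assume i: "i < n"
    have mem: "x \<in> d ` {..<n} \<longleftrightarrow> x = d i" if "x div 2 = i" for x
      using * i that by auto
    have "d i = 2 * i \<or> d i = Suc (2 * i)"
      using * i by (metis Suc_eq_plus1 mult_div_mod_eq add_0_right not_mod_2_eq_1_eq_0)
    then show "of_bool (2 * i \<in> d ` {..<n}) + of_bool (Suc (2 * i) \<in> d ` {..<n}) = (1 :: int)"
      using mem[of "2 * i"] mem[of "Suc (2 * i)"] by auto
  qed
next
  assume *: "\<forall>i<n. of_bool (2 * i \<in> d ` {..<n}) + of_bool (Suc (2 * i) \<in> d ` {..<n}) = (1 :: int)"
  let ?g = "\<lambda>i\<in>{..<n}. d i div 2"
  have "?g i < ?g j" if ij: "i < j" "j < n" for i j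
  proof (rule ccontr)
    assume "\<not> ?thesis"
    moreover have "d i < d j"
      by (rule increasing_rowsD(2)[OF d ij])
    \<comment> \<open>Numbers \<open>d i < d j\<close> whose halves do not increase are the two
      members of one pair.\<close>
    ultimately have "d i = 2 * (d i div 2)" "d j = Suc (2 * (d i div 2))"
      using ij by auto
    then have "2 * (d i div 2) \<in> d ` {..<n}" "Suc (2 * (d i div 2)) \<in> d ` {..<n}"
      using ij by (metis imageI lessThan_iff order_less_trans)+
    moreover have "d i div 2 < n"
      using increasing_rowsD(1)[OF d, of i] ij by auto
    ultimately show False
      using * by fastforce
  qed
  moreover have "?g i < n" if "i < n" for i
    using increasing_rowsD(1)[OF d that] that by auto
  ultimately have "?g \<in> increasing_rows n n"
    by (auto simp: increasing_rows_def strict_mono_on_def)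
  from increasing_rows_self[OF this] show "\<forall>i<n. d i div 2 = i"
    by auto
qed

section \<open>Matrices encoded by sequences of sets of rows\<close>

lemma sum_telescope_down:
  fixes f :: "nat \<Rightarrow> int"
  assumes "p \<le> n"
  shows "(\<Sum>q=p..<n. f q - f (Suc q)) = f p - f n"
  using sum_Suc_diff'[OF assms, of "\<lambda>q. - f q"] by simp

text \<open>If \<open>S 0\<close> is empty, this is the matrix in which the last \<open>m\<close>
  entries of row \<open>c\<close> sum to the indicator of \<open>c \<in> S m\<close>, for
  \<open>m \<le> n\<close>.\<close>

definition matrix_of_sets :: "nat \<Rightarrow> (nat \<Rightarrow> nat set) \<Rightarrow> int mat" where
  "matrix_of_sets n S =
    mat (2 * n) n (\<lambda>(c, q). of_bool (c \<in> S (n - q)) - of_bool (c \<in> S (n - Suc q)))"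

lemma matrix_of_sets_row_sum:
  assumes "c < 2 * n" "p \<le> n" "S 0 = {}"
  shows "(\<Sum>q=p..<n. matrix_of_sets n S $$ (c, q)) = of_bool (c \<in> S (n - p))"
proof -
  have "(\<Sum>q=p..<n. matrix_of_sets n S $$ (c, q))
      = (\<Sum>q=p..<n. of_bool (c \<in> S (n - q)) - of_bool (c \<in> S (n - Suc q)))"
    using assms by (intro sum.cong) (auto simp: matrix_of_sets_def)
  also have "\<dots> = of_bool (c \<in> S (n - p)) - of_bool (c \<in> S (n - n))"
    by (rule sum_telescope_down[OF assms(2)])
  finally show ?thesis
    using assms by simp
qed

text \<open>Column \<open>n - Suc m\<close> records the passage from \<open>S m\<close> to
  \<open>S (Suc m)\<close>, so its tail sums compare their tail counts.\<close>

lemma matrix_of_sets_col_sum: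
  assumes "m < n" "\<And>m. S m \<subseteq> {..<2 * n}"
  shows "(\<Sum>c=j..<2 * n. matrix_of_sets n S $$ (c, n - Suc m))
    = int (card (S (Suc m) \<inter> {j..})) - int (card (S m \<inter> {j..}))"
proof -
  have "{j..<2 * n} \<inter> S k = S k \<inter> {j..}" for k
    using assms(2)[of k] by auto
  then have count: "(\<Sum>c=j..<2 * n. of_bool (c \<in> S k)) = int (card (S k \<inter> {j..}))" for k
    by (simp add: sum_of_bool_eq)
  have "(\<Sum>c=j..<2 * n. matrix_of_sets n S $$ (c, n - Suc m))
      = (\<Sum>c=j..<2 * n. of_bool (c \<in> S (Suc m)) - of_bool (c \<in> S m))"
    using assms by (intro sum.cong) (auto simp: matrix_of_sets_def Suc_diff_Suc)
  then show ?thesis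
    by (simp add: sum_subtractf count)
qed

text \<open>Entries and row tails are right by construction; there remain the column tails, the
  paired rows and the column totals, each expressed through the sets.\<close>

lemma matrix_of_sets_in_uturn_iff:
  assumes S: "\<And>m. S m \<subseteq> {..<2 * n}" "S 0 = {}"
  shows "matrix_of_sets n S \<in> uturn_matrices n \<longleftrightarrow>
    (\<forall>m<n. \<forall>j<2 * n. int (card (S (Suc m) \<inter> {j..})) - int (card (S m \<inter> {j..})) \<in> {0, 1}) \<and>
    (\<forall>i<n. of_bool (2 * i \<in> S n) + of_bool (Suc (2 * i) \<in> S n) = (1 :: int)) \<and>
    (\<forall>m<n. card (S (Suc m)) = Suc (card (S m)))"
proof -
  let ?A = "matrix_of_sets n S"
  \<comment> \<open>Columns are numbered from the left, but the sets by tail length, hence from the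
    right.\<close>
  have reindex: "(\<forall>q<n. P q) \<longleftrightarrow> (\<forall>m<n. P (n - Suc m))" for P
    by (metis Suc_diff_Suc diff_Suc_less diff_diff_cancel less_imp_le_nat less_nat_zero_code not_gr_zero Suc_leI)
  have "(\<Sum>q<n. ?A $$ (2 * i, q) + ?A $$ (2 * i + 1, q))
      = of_bool (2 * i \<in> S n) + of_bool (Suc (2 * i) \<in> S n)" if "i < n" for i
    using that matrix_of_sets_row_sum[of "2 * i" n 0 S] matrix_of_sets_row_sum[of "Suc (2 * i)" n 0 S] S(2)
    by (simp add: sum.distrib lessThan_atLeast0)
  then have pairs: "(\<forall>i<n. (\<Sum>q<n. ?A $$ (2 * i, q) + ?A $$ (2 * i + 1, q)) = 1) \<longleftrightarrow>
      (\<forall>i<n. of_bool (2 * i \<in> S n) + of_bool (Suc (2 * i) \<in> S n) = (1 :: int))"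
    by simp
  have cols: "(\<forall>j<2 * n. \<forall>q<n. (\<Sum>i=j..<2 * n. ?A $$ (i, q)) \<in> {0, 1}) \<longleftrightarrow>
      (\<forall>m<n. \<forall>j<2 * n. int (card (S (Suc m) \<inter> {j..})) - int (card (S m \<inter> {j..})) \<in> {0, 1})"
    by (subst reindex) (simp add: matrix_of_sets_col_sum S, blast)
  have "S m \<inter> {0..} = S m" for m
    by auto
  then have total: "(\<forall>q<n. (\<Sum>i<2 * n. ?A $$ (i, q)) = 1) \<longleftrightarrow> (\<forall>m<n. card (S (Suc m)) = Suc (card (S m)))"
    using matrix_of_sets_col_sum[of _ n S 0] S by (subst reindex) (auto simp: lessThan_atLeast0)
  have "?A \<in> carrier_mat (2 * n) n"
    "\<forall>i<2 * n. \<forall>q<n. ?A $$ (i, q) \<in> {-1, 0, 1}"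
    "\<forall>i<2 * n. \<forall>p<n. (\<Sum>q=p..<n. ?A $$ (i, q)) \<in> {0, 1}"
    using matrix_of_sets_row_sum S by (auto simp: matrix_of_sets_def)
  then show ?thesis
    unfolding uturn_matrices_def mem_Collect_eq pairs cols total by blast
qed

text \<open>Row tail sums are 0 or 1, hence indicators of sets, and each entry is the difference of
  two successive tail sums.\<close>

lemma uturn_matrix_eq_matrix_of_sets:
  assumes A: "A \<in> uturn_matrices n"
  obtains S where "\<forall>m. S m \<subseteq> {..<2 * n}" "S 0 = {}" "A = matrix_of_sets n S"
proof
  define S where "S m = {c \<in> {..<2 * n}. (\<Sum>q=n-m..<n. A $$ (c, q)) = 1}" for m
  have partial: "(\<Sum>q=p..<n. A $$ (c, q)) = of_bool (c \<in> S (n - p))" if "c < 2 * n" "p \<le> n" for c p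
  \<comment> \<open>The empty tail \<open>p = n\<close> is outside the range of the row condition;
    its sum is 0 and \<open>S 0\<close> is empty.\<close>
  proof (cases "p = n")
    case False
    then have "(\<Sum>q=p..<n. A $$ (c, q)) \<in> {0, 1}"
      using A that by (simp add: uturn_matrices_def)
    then show ?thesis
      using that by (auto simp: S_def)
  qed (auto simp: S_def)
  show "\<forall>m. S m \<subseteq> {..<2 * n}" "S 0 = {}"
    by (auto simp: S_def)
  show "A = matrix_of_sets n S"
  proof (rule eq_matI)
    fix c q assume "c < dim_row (matrix_of_sets n S)" "q < dim_col (matrix_of_sets n S)"
    then have cq: "c < 2 * n" "q < n"
      by (simp_all add: matrix_of_sets_def)
    have "A $$ (c, q) = (\<Sum>k=q..<n. A $$ (c, k)) - (\<Sum>k=Suc q..<n. A $$ (c, k))"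
      using cq by (simp add: sum.atLeast_Suc_lessThan)
    then show "A $$ (c, q) = matrix_of_sets n S $$ (c, q)"
      using cq partial[of c q] partial[of c "Suc q"] by (simp add: matrix_of_sets_def)
  qed (use A in \<open>auto simp: uturn_matrices_def matrix_of_sets_def\<close>)
qed

section \<open>Triangles as U-turn matrices\<close>

text \<open>Beyond row \<open>n\<close> a triangle is \<open>undefined\<close>; the empty set there
  keeps all sets inside \<open>{..<2 * n}\<close>.\<close>

definition uturn_of_triangle :: "nat \<Rightarrow> (nat \<Rightarrow> nat \<Rightarrow> nat) \<Rightarrow> int mat" where
  "uturn_of_triangle n E = matrix_of_sets n (\<lambda>m. if m \<le> n then E m ` {..<m} else {})"

text \<open>The entries -1 of column \<open>q\<close> stand at the values of row
  \<open>n - Suc q\<close> that are missing from row \<open>n - q\<close>.\<close>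

lemma neg_uturn_of_triangle:
  assumes "E \<in> triangles (2 * n) n"
  shows "neg (uturn_of_triangle n E) = departures n E"
proof -
  define S where "S m = (if m \<le> n then E m ` {..<m} else {})" for m
  have sub: "S m \<subseteq> {..<2 * n}" for m
    using assms increasing_rowsD(1)[of "E m" "2 * n" m] by (auto simp: S_def triangles_def PiE_iff)
  let ?A = "matrix_of_sets n S"
  have "{(i, q). i < dim_row ?A \<and> q < dim_col ?A \<and> ?A $$ (i, q) = -1}
      = (\<lambda>(q, i). (i, q)) ` (SIGMA q:{..<n}. S (n - Suc q) - S (n - q))"
    using sub by (fastforce simp: matrix_of_sets_def of_bool_def split: if_splits)
  then have "neg ?A = card ((\<lambda>(q, i). (i, q)) ` (SIGMA q:{..<n}. S (n - Suc q) - S (n - q)))"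
    by (simp add: neg_def)
  also have "\<dots> = card (SIGMA q:{..<n}. S (n - Suc q) - S (n - q))"
    by (rule card_image) (auto simp: inj_on_def)
  also have "\<dots> = (\<Sum>q<n. card (S (n - Suc q) - S (n - q)))"
    using finite_subset[OF sub] by (intro card_SigmaI) auto
  also have "\<dots> = (\<Sum>q<n. card (S (n - Suc q) - S (Suc (n - Suc q))))"
    by (intro sum.cong) (auto simp: Suc_diff_Suc)
  also have "\<dots> = (\<Sum>m<n. card (S m - S (Suc m)))"
    by (rule sum.nat_diff_reindex)
  also have "\<dots> = departures n E"
    unfolding departures_def by (rule sum.cong) (auto simp: S_def)
  finally show ?thesis
    by (simp add: uturn_of_triangle_def S_def[abs_def])
qed

text \<open>Row tail sums recover the value sets of the triangle, and these its rows, which gives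
  injectivity. For surjectivity the column totals force the set of index \<open>m\<close> to have
  \<open>m\<close> elements, and sorting it yields a row.\<close>

lemma bij_betw_uturn_of_triangle:
  "bij_betw (uturn_of_triangle n) (symplectic_triangles n) (uturn_matrices n)"
proof -
  define S where "S E m = (if m \<le> n then E m ` {..<m} else {})" for E :: "nat \<Rightarrow> nat \<Rightarrow> nat" and m
  have U: "uturn_of_triangle n E = matrix_of_sets n (S E)" for E
    by (simp add: uturn_of_triangle_def S_def[abs_def])
  have S0: "S E 0 = {}" for E
    by (simp add: S_def)
  have sub: "S E m \<subseteq> {..<2 * n}" if "\<And>m. m \<le> n \<Longrightarrow> E m \<in> increasing_rows (2 * n) m" for E m
    using increasing_rowsD(1)[OF that] by (auto simp: S_def)
  have iff: "matrix_of_sets n (S E) \<in> uturn_matrices n \<longleftrightarrow> E \<in> symplectic_triangles n"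
    if E: "\<And>m. m \<le> n \<Longrightarrow> E m \<in> increasing_rows (2 * n) m" "E \<in> extensional {..n}" for E
  proof -
    have "(\<forall>m<n. \<forall>j<2 * n. int (card (S E (Suc m) \<inter> {j..})) - int (card (S E m \<inter> {j..})) \<in> {0, 1})
        \<longleftrightarrow> (\<forall>m<n. interlaced m (E m) (E (Suc m)))"
      using interlaced_iff_card[OF E(1) E(1)] by (simp add: S_def del: image_Suc_lessThan)
    moreover have "(\<forall>i<n. of_bool (2 * i \<in> S E n) + of_bool (Suc (2 * i) \<in> S E n) = (1 :: int))
        \<longleftrightarrow> (\<forall>i<n. E n i div 2 = i)"
      using increasing_rows_div_2_iff[OF E(1)] by (simp add: S_def)
    moreover have "\<forall>m<n. card (S E (Suc m)) = Suc (card (S E m))"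
      using card_increasing_rows[OF E(1)] by (simp add: S_def)
    moreover have S_sub: "S E m \<subseteq> {..<2 * n}" for m
      by (rule sub) (rule E(1))
    ultimately show ?thesis
      using E by (simp add: matrix_of_sets_in_uturn_iff[of "S E", OF S_sub S0]
          symplectic_triangles_def triangles_def PiE_iff)
  qed
  have rows: "E m \<in> increasing_rows (2 * n) m" "E \<in> extensional {..n}"
    if "E \<in> symplectic_triangles n" "m \<le> n" for E m
    using that by (auto simp: symplectic_triangles_def triangles_def PiE_iff)
  show ?thesis
    unfolding bij_betw_def
  proof
    show "inj_on (uturn_of_triangle n) (symplectic_triangles n)"
    proof (rule inj_onI)
      fix E F assume E: "E \<in> symplectic_triangles n" and F: "F \<in> symplectic_triangles n"
        and eq: "uturn_of_triangle n E = uturn_of_triangle n F"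
      show "E = F"
      proof (rule extensionalityI[OF rows(2)[OF E le0] rows(2)[OF F le0]])
        fix m assume "m \<in> {..n}"
        then have m: "m \<le> n" by simp
        have "c \<in> S E m \<longleftrightarrow> c \<in> S F m" if "c < 2 * n" for c
        proof -
          have "of_bool (c \<in> S E m) = (of_bool (c \<in> S F m) :: int)"
            using eq matrix_of_sets_row_sum[OF that, of "n - m" "S E"]
              matrix_of_sets_row_sum[OF that, of "n - m" "S F"] m
            by (simp add: S0 U)
          then show ?thesis
            by (simp only: of_bool_eq_iff)
        qed
        then have "S E m = S F m"
          using sub[of E m] sub[of F m] rows(1)[OF E] rows(1)[OF F] by blast
        then show "E m = F m"
          using increasing_rows_eqI[OF rows(1)[OF E m] rows(1)[OF F m]] m by (simp add: S_def)
      qed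
    qed
    show "uturn_of_triangle n ` symplectic_triangles n = uturn_matrices n"
    proof (intro equalityI subsetI)
      fix A assume "A \<in> uturn_of_triangle n ` symplectic_triangles n"
      then obtain E where E: "E \<in> symplectic_triangles n" "A = matrix_of_sets n (S E)"
        using U by auto
      then show "A \<in> uturn_matrices n"
        using iff[OF rows(1)[OF E(1)] rows(2)[OF E(1) le0]] by simp
    next
      fix A assume A: "A \<in> uturn_matrices n"
      then obtain X where "\<forall>m. X m \<subseteq> {..<2 * n}" and X: "X 0 = {}" "A = matrix_of_sets n X"
        by (rule uturn_matrix_eq_matrix_of_sets)
      then have X_sub: "X m \<subseteq> {..<2 * n}" for m
        by blast
      have step: "\<forall>m<n. card (X (Suc m)) = Suc (card (X m))"
        using A X(2) matrix_of_sets_in_uturn_iff[of X, OF X_sub X(1)] by auto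
      have "card (X m) = m" if "m \<le> n" for m
        using that by (induction m) (use X(1) step in auto)
      then have "\<exists>e. e \<in> increasing_rows (2 * n) m \<and> e ` {..<m} = X m" if "m \<le> n" for m
        using ex_increasing_row[OF X_sub] that by blast
      then obtain e where e: "\<And>m. m \<le> n \<Longrightarrow> e m \<in> increasing_rows (2 * n) m"
        "\<And>m. m \<le> n \<Longrightarrow> e m ` {..<m} = X m"
        by metis
      define E where "E = restrict e {..n}"
      \<comment> \<open>The matrix reads only sets of index at most \<open>n\<close>, where
        \<open>S E\<close> and \<open>X\<close> agree.\<close>
      have "A = matrix_of_sets n (S E)"
        unfolding X(2) matrix_of_sets_def
        by (rule cong_mat) (auto simp: S_def E_def e(2))
      moreover from this have "E \<in> symplectic_triangles n"
        using iff[of E] A e(1) by (auto simp: E_def)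
      ultimately show "A \<in> uturn_of_triangle n ` symplectic_triangles n"
        using U[of E] by (intro image_eqI) simp_all
    qed
  qed
qed

lemma sum_uturn_matrices:
  "(\<Sum>A \<in> uturn_matrices n. (2 :: real) ^ neg A) = 2 ^ (n\<^sup>2)"
proof -
  have "(\<Sum>A \<in> uturn_matrices n. (2 :: real) ^ neg A)
      = (\<Sum>E \<in> symplectic_triangles n. 2 ^ neg (uturn_of_triangle n E))"
    by (rule sum.reindex_bij_betw[OF bij_betw_uturn_of_triangle, symmetric])
  also have "\<dots> = of_int (\<Sum>E \<in> symplectic_triangles n. 2 ^ departures n E)"
    by (auto simp: neg_uturn_of_triangle symplectic_triangles_def intro!: sum.cong)
  also have "\<dots> = 2 ^ (n\<^sup>2)"
    by (subst sum_symplectic_triangles) simp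
  finally show ?thesis .
qed

section \<open>Square ice\<close>

definition compass_value :: "compass \<Rightarrow> int" where
  "compass_value c = (case c of WE \<Rightarrow> 1 | NS \<Rightarrow> -1 | _ \<Rightarrow> 0)"

text \<open>Chosen so that the edge left of column \<open>p\<close> carries the sum of its row from
  column \<open>p\<close> on; \<open>vval\<close> does the same for the edge above a vertex and the
  column sum from there down.\<close>

definition hval :: "hdir \<Rightarrow> int" where
  "hval d = of_bool (d = Rightward)"

definition vval :: "vdir \<Rightarrow> int" where
  "vval d = of_bool (d = Upward)"

lemma hval_simps [simp]: "hval Leftward = 0" "hval Rightward = 1"
  by (simp_all add: hval_def)

lemma vval_simps [simp]: "vval Downward = 0" "vval Upward = 1"
  by (simp_all add: vval_def)

lemma hval_inject [simp]: "hval d = hval d' \<longleftrightarrow> d = d'"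
  by (cases d; cases d') simp_all

lemma vval_inject [simp]: "vval d = vval d' \<longleftrightarrow> d = d'"
  by (cases d; cases d') simp_all

lemma hval_cases: "hval d \<in> {0, 1}"
  by (cases d) simp_all

lemma vval_cases: "vval d \<in> {0, 1}"
  by (cases d) simp_all

lemma incoming_eq:
  "incoming h v i j = (if h i j = Rightward then {LeftSide} else {})
    \<union> (if h i (j + 1) = Leftward then {RightSide} else {})
    \<union> (if v i j = Downward then {UpSide} else {})
    \<union> (if v (i + 1) j = Upward then {DownSide} else {})"
  (is "_ = ?R")
proof (rule Set.set_eqI)
  fix s
  show "s \<in> incoming h v i j \<longleftrightarrow> s \<in> ?R"
    by (cases s) (auto simp: incoming_def)
qed

lemma outgoing_eq:
  "outgoing h v i j = (if h i j = Rightward then {} else {LeftSide})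
    \<union> (if h i (j + 1) = Leftward then {} else {RightSide})
    \<union> (if v i j = Downward then {} else {UpSide})
    \<union> (if v (i + 1) j = Upward then {} else {DownSide})"
  (is "_ = ?R")
proof (rule Set.set_eqI)
  fix s
  show "s \<in> outgoing h v i j \<longleftrightarrow> s \<in> ?R"
    by (cases s) (auto simp: outgoing_def incoming_def)
qed

text \<open>The number of incoming edges is \<open>hval\<close> of the left edge plus
  \<open>vval\<close> of the lower edge plus the complements to 1 of the other two values. It is 2
  exactly when the horizontal and the vertical drop agree.\<close>

lemma ice_rule_iff:
  "card (incoming h v i j) = 2 \<and> card (outgoing h v i j) = 2
    \<longleftrightarrow> hval (h i j) - hval (h i (j + 1)) = vval (v i j) - vval (v (i + 1) j)"
  unfolding incoming_eq outgoing_eq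
  by (cases "h i j"; cases "h i (j + 1)"; cases "v i j"; cases "v (i + 1) j") simp_all

text \<open>The ice rule leaves six orientations at a vertex: the horizontal drop is 1 for
  \<open>WE\<close>, -1 for \<open>NS\<close> and 0 for the four turns.\<close>

lemma compass_value_vertex:
  assumes "hval (h i j) - hval (h i (j + 1)) = vval (v i j) - vval (v (i + 1) j)"
  shows "compass_value (vertex_compass h v i j) = hval (h i j) - hval (h i (j + 1))"
  using assms unfolding vertex_compass_def incoming_eq outgoing_eq compass_value_def
  by (cases "h i j"; cases "h i (j + 1)"; cases "v i j"; cases "v (i + 1) j")
    (simp_all add: doubleton_eq_iff)

lemma square_ice_iff:
  "square_ice n h v \<longleftrightarrow>
    (\<forall>i<2 * n. \<forall>j<n. hval (h i j) - hval (h i (Suc j)) = vval (v i j) - vval (v (Suc i) j)) \<and>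
    (\<forall>i<2 * n. h i n = Leftward) \<and> (\<forall>j<n. v (2 * n) j = Downward) \<and> (\<forall>j<n. v 0 j = Upward) \<and>
    (\<forall>i<n. hval (h (2 * i) 0) + hval (h (2 * i + 1) 0) = 1)"
proof -
  have "(a = Rightward \<and> b = Leftward) \<or> (a = Leftward \<and> b = Rightward) \<longleftrightarrow> hval a + hval b = 1" for a b
    by (cases a; cases b) simp_all
  then show ?thesis
    unfolding square_ice_def ice_rule_iff by simp
qed

text \<open>An entry is both the horizontal and the vertical drop at its vertex. Edges on the right
  and the lower border have value 0, so tail sums telescope to edge values. Hence the matrix
  determines the orientation of the grid.\<close>

lemma ice_matrix_sums:
  assumes ice: "square_ice n h v"
  defines "A \<equiv> map_mat compass_value (mat (2 * n) n (\<lambda>(i, j). vertex_compass h v i j))"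
  shows "i < 2 * n \<Longrightarrow> p \<le> n \<Longrightarrow> (\<Sum>q=p..<n. A $$ (i, q)) = hval (h i p)"
    and "j \<le> 2 * n \<Longrightarrow> q < n \<Longrightarrow> (\<Sum>i=j..<2 * n. A $$ (i, q)) = vval (v j q)"
proof -
  have A: "A $$ (i, q) = hval (h i q) - hval (h i (Suc q))"
    "A $$ (i, q) = vval (v i q) - vval (v (Suc i) q)" if "i < 2 * n" "q < n" for i q
    using ice that compass_value_vertex[of h i q v] by (auto simp: square_ice_iff A_def)
  show "(\<Sum>q=p..<n. A $$ (i, q)) = hval (h i p)" if "i < 2 * n" "p \<le> n"
  proof -
    have "(\<Sum>q=p..<n. A $$ (i, q)) = (\<Sum>q=p..<n. hval (h i q) - hval (h i (Suc q)))"
      using that by (intro sum.cong) (auto simp: A(1))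
    then show ?thesis
      using sum_telescope_down[OF that(2), of "\<lambda>q. hval (h i q)"] ice that
      by (simp add: square_ice_iff)
  qed
  show "(\<Sum>i=j..<2 * n. A $$ (i, q)) = vval (v j q)" if "j \<le> 2 * n" "q < n"
  proof -
    have "(\<Sum>i=j..<2 * n. A $$ (i, q)) = (\<Sum>i=j..<2 * n. vval (v i q) - vval (v (Suc i) q))"
      using that by (intro sum.cong) (auto simp: A(2))
    then show ?thesis
      using sum_telescope_down[OF that(1), of "\<lambda>i. vval (v i q)"] ice that
      by (simp add: square_ice_iff)
  qed
qed

text \<open>Orientations and tail sums determine each other. Outgoing top edges correspond to column
  totals 1, and the left edges of paired rows to the U-turn condition.\<close>

lemma bij_betw_compass_matrices:
  "bij_betw (map_mat compass_value) (compass_matrices n) (uturn_matrices n)"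
proof -
  define ice_mat where "ice_mat h v = mat (2 * n) n (\<lambda>(i, j). vertex_compass h v i j)" for h v
  have CM: "compass_matrices n = {ice_mat h v | h v. square_ice n h v}"
    by (simp add: compass_matrices_def ice_mat_def)
  let ?f = "map_mat compass_value"
  note sums = ice_matrix_sums[of n, folded ice_mat_def]
  have into: "?f (ice_mat h v) \<in> uturn_matrices n" if ice: "square_ice n h v" for h v
  proof -
    let ?A = "?f (ice_mat h v)"
    have "?A $$ (i, q) \<in> {-1, 0, 1}" if "i < 2 * n" "q < n" for i q
      using that by (auto simp: ice_mat_def compass_value_def split: compass.splits)
    moreover have "(\<Sum>q<n. ?A $$ (2 * i, q) + ?A $$ (2 * i + 1, q)) = 1" if "i < n" for i
      using sums(1)[OF ice, of "2 * i" 0] sums(1)[OF ice, of "2 * i + 1" 0] ice that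
      by (simp add: sum.distrib square_ice_iff lessThan_atLeast0)
    moreover have "(\<Sum>i<2 * n. ?A $$ (i, q)) = 1" if "q < n" for q
      using sums(2)[OF ice, of 0 q] ice that by (simp add: square_ice_iff lessThan_atLeast0)
    ultimately show ?thesis
      using sums[OF ice] hval_cases vval_cases
      unfolding uturn_matrices_def by (simp add: ice_mat_def)
  qed
  show ?thesis
    unfolding bij_betw_def
  proof
    show "inj_on ?f (compass_matrices n)"
    proof (rule inj_onI)
      fix C C' assume "C \<in> compass_matrices n" "C' \<in> compass_matrices n" and eq: "?f C = ?f C'"
      then obtain h v h' v' where C: "C = ice_mat h v" "square_ice n h v"
        and C': "C' = ice_mat h' v'" "square_ice n h' v'"
        by (auto simp: CM)
      have h: "h i p = h' i p" if "i < 2 * n" "p \<le> n" for i p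
        using sums(1)[OF C(2) that] sums(1)[OF C'(2) that] eq by (simp add: C(1) C'(1))
      have v: "v j q = v' j q" if "j \<le> 2 * n" "q < n" for j q
        using sums(2)[OF C(2) that] sums(2)[OF C'(2) that] eq by (simp add: C(1) C'(1))
      \<comment> \<open>\<open>h\<close> and \<open>h'\<close>, \<open>v\<close> and
        \<open>v'\<close> are known to agree only on edges of the grid, and a vertex reads only
        those.\<close>
      have "vertex_compass h v i j = vertex_compass h' v' i j" if "i < 2 * n" "j < n" for i j
        using that by (simp add: vertex_compass_def incoming_eq outgoing_eq h v)
      then show "C = C'"
        unfolding C(1) C'(1) ice_mat_def by (intro cong_mat) auto
    qed
    show "?f ` compass_matrices n = uturn_matrices n"
    proof (intro equalityI subsetI)
      fix A assume "A \<in> ?f ` compass_matrices n"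
      then show "A \<in> uturn_matrices n"
        using into by (auto simp: CM)
    next
      fix A assume A: "A \<in> uturn_matrices n"
      define h where "h i p = (if (\<Sum>q=p..<n. A $$ (i, q)) = 1 then Rightward else Leftward)" for i p
      define v where "v j q = (if (\<Sum>i=j..<2 * n. A $$ (i, q)) = 1 then Upward else Downward)" for j q
      have h: "hval (h i p) = (\<Sum>q=p..<n. A $$ (i, q))" if "i < 2 * n" "p \<le> n" for i p
      \<comment> \<open>On the right border the tail is empty with sum 0, and the definition of
        \<open>h\<close> yields \<open>Leftward\<close>, as the boundary condition asks.\<close>
      proof (cases "p = n")
        case False
        then have "(\<Sum>q=p..<n. A $$ (i, q)) \<in> {0, 1}"
          using A that by (simp add: uturn_matrices_def)
        then show ?thesis by (auto simp: h_def)
      qed (simp add: h_def)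
      have v: "vval (v j q) = (\<Sum>i=j..<2 * n. A $$ (i, q))" if "j \<le> 2 * n" "q < n" for j q
      proof (cases "j = 2 * n")
        case False
        then have "(\<Sum>i=j..<2 * n. A $$ (i, q)) \<in> {0, 1}"
          using A that by (simp add: uturn_matrices_def)
        then show ?thesis by (auto simp: v_def)
      qed (simp add: v_def)
      have Ah: "A $$ (i, q) = hval (h i q) - hval (h i (Suc q))" if "i < 2 * n" "q < n" for i q
        using that by (simp add: h sum.atLeast_Suc_lessThan)
      have Av: "A $$ (i, q) = vval (v i q) - vval (v (Suc i) q)" if "i < 2 * n" "q < n" for i q
        using that by (simp add: v sum.atLeast_Suc_lessThan)
      have "v 0 q = Upward" if "q < n" for q
        using A that by (simp add: v_def uturn_matrices_def lessThan_atLeast0)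
      moreover have "hval (h (2 * i) 0) + hval (h (2 * i + 1) 0) = 1" if "i < n" for i
        using A that h[of "2 * i" 0] h[of "2 * i + 1" 0]
        by (simp add: uturn_matrices_def sum.distrib lessThan_atLeast0)
      \<comment> \<open>Both drops equal the same matrix entry, which is the ice rule.\<close>
      moreover have "hval (h i j) - hval (h i (Suc j)) = vval (v i j) - vval (v (Suc i) j)"
        if "i < 2 * n" "j < n" for i j
        using Ah[OF that] Av[OF that] by simp
      moreover have "h i n = Leftward" "v (2 * n) j = Downward" for i j
        by (simp_all add: h_def v_def)
      ultimately have ice: "square_ice n h v"
        unfolding square_ice_iff by blast
      have "A = ?f (ice_mat h v)"
      proof (rule eq_matI)
        fix i q assume "i < dim_row (?f (ice_mat h v))" "q < dim_col (?f (ice_mat h v))"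
        then have iq: "i < 2 * n" "q < n"
          by (simp_all add: ice_mat_def)
        then show "A $$ (i, q) = ?f (ice_mat h v) $$ (i, q)"
          using compass_value_vertex[of h i q v] Ah[OF iq] Av[OF iq] by (simp add: ice_mat_def)
      qed (use A in \<open>auto simp: uturn_matrices_def ice_mat_def\<close>)
      then show "A \<in> ?f ` compass_matrices n"
        using ice by (auto simp: CM)
    qed
  qed
qed

lemma neg_map_compass_value: "neg (map_mat compass_value C) = ns C"
proof -
  have "compass_value c = -1 \<longleftrightarrow> c = NS" for c
    by (cases c) (simp_all add: compass_value_def)
  then have "{(i, q). i < dim_row (map_mat compass_value C) \<and> q < dim_col (map_mat compass_value C)
        \<and> map_mat compass_value C $$ (i, q) = -1}
      = {(i, j). i < dim_row C \<and> j < dim_col C \<and> C $$ (i, j) = NS}"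
    by (intro Collect_cong) (simp add: case_prod_unfold cong: conj_cong)
  then show ?thesis
    unfolding neg_def ns_def by (rule arg_cong)
qed

lemma sum_compass_matrices:
  "(\<Sum>C \<in> compass_matrices n. (2 :: real) ^ ns C) = (\<Sum>A \<in> uturn_matrices n. 2 ^ neg A)"
  using sum.reindex_bij_betw[OF bij_betw_compass_matrices, of "\<lambda>A. (2 :: real) ^ neg A"]
  by (simp add: neg_map_compass_value)

theorem corollary6p9:
  fixes n :: nat
  assumes "n \<ge> 1"
  shows "(2 :: real) ^ (n ^ 2) = (\<Sum>ST \<in> shifted_tableaux n. 2 powi (int (str n ST) - int n))
    \<and> (\<Sum>ST \<in> shifted_tableaux n. (2 :: real) powi (int (str n ST) - int n))
        = (\<Sum>UA \<in> uturn_matrices n. 2 ^ neg UA)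
    \<and> (\<Sum>UA \<in> uturn_matrices n. (2 :: real) ^ neg UA) = (\<Sum>CM \<in> compass_matrices n. 2 ^ ns CM)"
  using sum_shifted_tableaux[of n] sum_uturn_matrices[of n] sum_compass_matrices[of n] by simp

end
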